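(* Consider the linear system with multiple time-varying input delays $$\dot{x}(t)=Ax(t)+\sum_{i=1}^{q}B_{i}u(t-\tau_{i}(t)),\qquad t\ge 0,$$ where $x\in\mathbf{R}^{n}$, $u\in\mathbf{R}^{m}$, and $A\in\mathbf{R}^{n\times n}$, $B_{i}\in\mathbf{R}^{n\times m}$ ($i=1,\ldots,q$) are constant matrices. Let $B=B_{1}+B_{2}+\cdots+B_{q}$. Assume that $(A,B)$ is controllable and that all the eigenvalues of $A$ are zero. Assume that there exist constants $\bar{\tau}>0$ and $d\in[0,1)$ (not used in the controller) such that $$0\leq\tau_{i}(t)\leq\bar{\tau},\qquad \dot{\tau}_{i}(t)\leq d,\qquad \forall t\geq 0,\ i=1,\ldots,q.$$ Let $\gamma_{0}>0$, $\omega>0$ and $\mu\in(0,1)$ be arbitrary constants, and set $$\gamma(t)=\frac{\gamma_{0}}{(\omega t+1)^{\mu}},\qquad t\in[0,\infty).$$ Then the system is asymptotically stabilized by the linear time-varying state feedback $$u(t)=-B^{\mathrm{T}}P(\gamma(t))x(t),\qquad t\ge 0,$$ where, for each $\gamma>0$, $P(\gamma)$ is the unique positive definite solution to the parametric Lyapunov equation $A^{\mathrm{T}}P+PA-PBB^{\mathrm{T}}P=-\gamma P$; that is, the zero solution of the closed-loop system is asymptotically stable.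
   Context: Under the stated hypotheses on $(A,B)$, the parametric Lyapunov equation $A^{\mathrm{T}}P+PA-PBB^{\mathrm{T}}P=-\gamma P$ has a unique positive definite solution $P(\gamma)$ for every $\gamma>0$. The delays $\tau_i:[0,\infty)\to\mathbf{R}$ are differentiable. The initial condition is $x(0)=x_{0}\in\mathbf{R}^n$ and $u(\theta)=u_{0}(\theta)$ for $\theta\in[-\bar{\tau},0)$, with $u_0$ bounded (and measurable); the feedback law defines $u(t)$ for $t\ge 0$. Asymptotic stability of the zero solution of the closed-loop system means: (i) (Lyapunov stability) for every $\varepsilon>0$ there exists $\delta_{0}>0$ such that $\|x_{0}\|+\sup_{\theta\in[-\bar{\tau},0)}\|u_{0}(\theta)\|\leq\delta_{0}$ implies $\|x(t)\|\leq\varepsilon$ for all $t\geq 0$; and (ii) (attractivity) $\lim_{t\to\infty}\|x(t)\|=0$ for every initial condition. *)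

theory Defs
  imports "HOL-Analysis.Analysis"
begin

text \<open>
  Initial control histories are only bounded and measurable, so differential equations are
  understood in the sense of Caratheodory: \<open>x\<close> is a solution of \<open>x'(t) = f(t)\<close> on \<open>{0..T}\<close> if it
  is an indefinite Lebesgue integral of \<open>f\<close> there (equivalently, \<open>x\<close> is absolutely continuous with
  \<open>x'(t) = f(t)\<close> for almost all \<open>t\<close>).
\<close>

definition integral_curve :: "(real \<Rightarrow> 'a::euclidean_space) \<Rightarrow> (real \<Rightarrow> 'a) \<Rightarrow> real \<Rightarrow> bool" where
  "integral_curve f x T \<longleftrightarrow>
     f absolutely_integrable_on {0..T} \<and> (\<forall>t\<in>{0..T}. x t = x 0 + integral {0..t} f)"

definition controllable :: "real^'n^'n \<Rightarrow> real^'m^'n \<Rightarrow> bool" where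
  "controllable A B \<longleftrightarrow>
     (\<forall>x0 x1. \<exists>T>0. \<exists>u x. u absolutely_integrable_on {0..T} \<and>
        integral_curve (\<lambda>s. A *v x s + B *v u s) x T \<and> x 0 = x0 \<and> x T = x1)"

text \<open>Eigenvalues of a real matrix are its complex eigenvalues.\<close>

definition eigenvalue :: "real^'n^'n \<Rightarrow> complex \<Rightarrow> bool" where
  "eigenvalue A z \<longleftrightarrow> (\<exists>v. v \<noteq> 0 \<and> map_matrix complex_of_real A *v v = z *s v)"

definition positive_definite :: "real^'n^'n \<Rightarrow> bool" where
  "positive_definite P \<longleftrightarrow> transpose P = P \<and> (\<forall>v. v \<noteq> 0 \<longrightarrow> v \<bullet> (P *v v) > 0)"

definition ple_solution :: "real^'n^'n \<Rightarrow> real^'m^'n \<Rightarrow> real \<Rightarrow> real^'n^'n" where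
  "ple_solution A B g =
     (THE P. positive_definite P \<and>
        transpose A ** P + P ** A - P ** B ** transpose B ** P = - (g *\<^sub>R P))"

definition admissible_history :: "real \<Rightarrow> (real \<Rightarrow> real^'m) \<Rightarrow> bool" where
  "admissible_history taubar u0 \<longleftrightarrow>
     bounded (u0 ` {-taubar..<0}) \<and> u0 \<in> borel_measurable (lebesgue_on {-taubar..<0})"

definition control :: "(real \<Rightarrow> real^'n^'m) \<Rightarrow> (real \<Rightarrow> real^'m) \<Rightarrow> (real \<Rightarrow> real^'n) \<Rightarrow> real \<Rightarrow> real^'m" where
  "control K u0 x t = (if t < 0 then u0 t else K t *v x t)"

text \<open>
  Solutions of the system with delays \<open>tau 1, \<dots>, tau q\<close> under the feedback \<open>u(t) = K(t) x(t)\<close>.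
  Only the values of \<open>x\<close> on \<open>{0..}\<close> matter.
\<close>

definition closed_loop_solution ::
  "real^'n^'n \<Rightarrow> nat \<Rightarrow> (nat \<Rightarrow> real^'m^'n) \<Rightarrow> (nat \<Rightarrow> real \<Rightarrow> real) \<Rightarrow> (real \<Rightarrow> real^'n^'m) \<Rightarrow>
   real^'n \<Rightarrow> (real \<Rightarrow> real^'m) \<Rightarrow> (real \<Rightarrow> real^'n) \<Rightarrow> bool" where
  "closed_loop_solution A q Bs tau K x0 u0 x \<longleftrightarrow>
     x 0 = x0 \<and>
     (\<forall>T\<ge>0. integral_curve
        (\<lambda>s. A *v x s + (\<Sum>i=1..q. Bs i *v control K u0 x (s - tau i s))) x T)"

text \<open>
  The first conjunct states that every initial condition has a global solution, so that the other
  two, which speak about all solutions, are not vacuous.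
\<close>

definition closed_loop_asymptotically_stable ::
  "real^'n^'n \<Rightarrow> nat \<Rightarrow> (nat \<Rightarrow> real^'m^'n) \<Rightarrow> (nat \<Rightarrow> real \<Rightarrow> real) \<Rightarrow> real \<Rightarrow>
   (real \<Rightarrow> real^'n^'m) \<Rightarrow> bool" where
  "closed_loop_asymptotically_stable A q Bs tau taubar K \<longleftrightarrow>
     (\<forall>x0 u0. admissible_history taubar u0 \<longrightarrow> (\<exists>x. closed_loop_solution A q Bs tau K x0 u0 x)) \<and>
     (\<forall>\<epsilon>>0. \<exists>\<delta>\<^sub>0>0. \<forall>x0 u0 x.
        admissible_history taubar u0 \<longrightarrow> closed_loop_solution A q Bs tau K x0 u0 x \<longrightarrow>
        norm x0 + (SUP \<theta>\<in>{-taubar..<0}. norm (u0 \<theta>)) \<le> \<delta>\<^sub>0 \<longrightarrow>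
        (\<forall>t\<ge>0. norm (x t) \<le> \<epsilon>)) \<and>
     (\<forall>x0 u0 x.
        admissible_history taubar u0 \<longrightarrow> closed_loop_solution A q Bs tau K x0 u0 x \<longrightarrow>
        ((\<lambda>t. norm (x t)) \<longlongrightarrow> 0) at_top)"

end

theory Submission
  imports
    Defs
    "HOL-Computational_Algebra.Fundamental_Theorem_Algebra"
    "HOL-Real_Asymp.Real_Asymp"
begin

text \<open>
  The inverse \<open>W = P(\<gamma>)\<^sup>-\<^sup>1\<close> solves the linear equation \<open>\<gamma> W + A W + W A\<^sup>T = B B\<^sup>T\<close>. As \<open>A\<close> is nilpotent,
  this equation is uniquely solvable and gives, in the norm \<open>|v|\<^sub>W = \<surd>(v \<bullet> W v)\<close> and uniformly for bounded \<open>\<gamma>\<close>,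
  the bounds \<open>|A\<^sup>T v|\<^sub>W \<le> n \<gamma> |v|\<^sub>W\<close>, \<open>|B\<^sup>T v| \<le> b \<surd>\<gamma> |v|\<^sub>W\<close>, \<open>|v| \<le> C \<surd>\<gamma> |v|\<^sub>W\<close> (controllability), and
  \<open>W \<le> C \<gamma>\<^sup>-\<^sup>p\<close>; moreover \<open>W\<close> decreases in \<open>\<gamma>\<close>.

  Put \<open>y = P(\<gamma>(t)) x\<close> and \<open>V = x \<bullet> y = |y|\<^sub>W\<^sup>2\<close>. Without delays \<open>V\<close> decays at rate \<open>\<gamma>\<close>. The delays replace
  \<open>B\<^sup>T y(t)\<close> by \<open>B\<^sup>T y(t - \<tau>\<^sub>i)\<close>; by the bounds above and \<open>\<gamma>(t - 2 \<tau>)/\<gamma>(t) \<rightarrow> 1\<close>, this costs only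
  \<open>o(\<gamma>)\<close> times the supremum of \<open>V\<close> over the last \<open>2 \<tau>\<close> time units. A Halanay comparison gives
  \<open>V(t) \<le> M exp(- \<integral>\<gamma>/2)\<close>, and since \<open>\<mu> < 1\<close> this beats the polynomial growth of \<open>W\<close> in \<open>|x|\<^sup>2 = |W y|\<^sup>2\<close>.
\<close>


section \<open>Nilpotency\<close>

text \<open>The obstacle is that \<open>taubar\<close> is arbitrary while \<open>x'\<close> is not
  small in the Euclidean norm. Measured with \<open>W\<close>, one delay changes
  \<open>B^T P x\<close> only by a relative amount of order \<open>taubar * \<gamma>\<close> plus
  the relative change of \<gamma>; both tend to zero, so the delay never has to be compared with a
  fixed gain. The change of \<open>x\<close> over one delay is itself driven by delayed controls,
  hence the look back over two delays. The quadratic equation for \<open>P\<close> is traded for the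
  linear one for \<open>W\<close> because differences then solve a linear equation too: monotonicity
  and Lipschitz dependence on the parameter follow, and reach \<open>P\<close> through
  \<open>P2 - P1 = P1 (W1 - W2) P2\<close>. Nilpotency replaces integral representations of
  \<open>W\<close> by finite inductions. Existence has a difficulty of its own:
  \<open>u0 (s - tau i s)\<close> must be measurable, and Lebesgue measurability does not survive
  composition with arbitrary continuous maps. Here \<open>d < 1\<close> enters:
  \<open>s - tau i s\<close> expands distances by at least \<open>1 - d\<close>.\<close>

definition poly_orbit :: "complex^'n^'n \<Rightarrow> complex poly \<Rightarrow> complex^'n \<Rightarrow> complex^'n" where
  "poly_orbit C p v = (\<Sum>i\<le>degree p. coeff p i *s (((*v) C ^^ i) v))"

lemma poly_orbit_bound:
  assumes "degree p \<le> N"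
  shows "poly_orbit C p v = (\<Sum>i\<le>N. coeff p i *s (((*v) C ^^ i) v))"
  unfolding poly_orbit_def
  by (rule sum.mono_neutral_left) (use assms in \<open>auto simp: coeff_eq_0\<close>)

lemma matrix_vector_mult_funpow_add:
  "((*v) C ^^ i) (C *v v) = C *v (((*v) C ^^ i) v)"
  by (metis comp_apply funpow_swap1)

lemma matrix_vector_mult_sum:
  fixes C :: "'a::field^'n^'m"
  shows "C *v (\<Sum>i\<in>I. f i) = (\<Sum>i\<in>I. C *v f i)"
  by (induction I rule: infinite_finite_induct) (auto simp: matrix_vector_right_distrib)

lemma poly_orbit_linear_factor:
  "poly_orbit C ([:-z, 1:] * p) v = C *v poly_orbit C p v - z *s poly_orbit C p v"
proof -
  let ?N = "degree p"
  have deg: "degree ([:-z, 1:] * p) \<le> Suc ?N"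
    by (rule order_trans[OF degree_mult_le]) simp
  have "poly_orbit C ([:-z, 1:] * p) v
      = (\<Sum>i\<le>Suc ?N. (coeff (pCons 0 p) i - z * coeff p i) *s (((*v) C ^^ i) v))"
    unfolding poly_orbit_bound[OF deg] by simp
  also have "\<dots> = (\<Sum>i\<le>Suc ?N. coeff (pCons 0 p) i *s (((*v) C ^^ i) v))
      - (\<Sum>i\<le>Suc ?N. (z * coeff p i) *s (((*v) C ^^ i) v))"
    by (simp only: sum_subtractf vector_sub_rdistrib)
  also have "(\<Sum>i\<le>Suc ?N. coeff (pCons 0 p) i *s (((*v) C ^^ i) v)) = C *v poly_orbit C p v"
    unfolding sum.atMost_Suc_shift
    by (simp add: poly_orbit_def matrix_vector_mult_sum vector_scalar_commute)
  also have "(\<Sum>i\<le>Suc ?N. (z * coeff p i) *s (((*v) C ^^ i) v)) = z *s poly_orbit C p v"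
    by (simp add: poly_orbit_def coeff_eq_0 vec.scale_sum_right)
  finally show ?thesis .
qed

lemma poly_orbit_apply: "poly_orbit C p (C *v v) = C *v poly_orbit C p v"
  by (simp add: poly_orbit_def matrix_vector_mult_funpow_add vec.scale_sum_right
       matrix_vector_mult_sum vector_scalar_commute)

text \<open>Split a root off: if \<open>p = (X - z) q\<close>, then \<open>w = q(C) v\<close>
  satisfies \<open>C w = z w\<close>. For \<open>z = 0\<close> the smaller polynomial
  \<open>q\<close> annihilates \<open>C v\<close>; for \<open>z \<noteq> 0\<close> the vector
  \<open>w\<close> cannot be an eigenvector, so \<open>q\<close> annihilates \<open>v\<close>
  itself.\<close>

lemma poly_orbit_zero_imp_nilpotent:
  assumes "\<And>z w. C *v w = z *s w \<Longrightarrow> w \<noteq> 0 \<Longrightarrow> z = 0"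
    and "p \<noteq> 0" and "poly_orbit C p v = 0"
  shows "\<exists>k. ((*v) C ^^ k) v = 0"
  using assms(2,3)
proof (induction "degree p" arbitrary: p v)
  case 0
  then obtain c where "p = [:c:]" "c \<noteq> 0" by (metis degree_eq_zeroE pCons_0_0)
  with 0 have "v = 0" by (simp add: poly_orbit_def)
  then show ?case by (intro exI[of _ 0]) simp
next
  case (Suc m)
  then have "\<not> constant (poly p)" by (simp add: constant_degree)
  then obtain z where "poly p z = 0" using fundamental_theorem_of_algebra by blast
  then obtain q where q: "p = [:-z, 1:] * q" by (auto simp: poly_eq_0_iff_dvd)
  with Suc have "q \<noteq> 0" by auto
  then have deg: "m = degree q"
    using Suc.hyps(2) unfolding q by (subst (asm) degree_mult_eq) auto
  have eq: "C *v poly_orbit C q v = z *s poly_orbit C q v"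
    using Suc.prems(2) unfolding q poly_orbit_linear_factor by simp
  show ?case
  proof (cases "z = 0")
    case True
    then have "poly_orbit C q (C *v v) = 0" using eq by (simp add: poly_orbit_apply)
    then obtain k where "((*v) C ^^ k) (C *v v) = 0" using Suc.hyps(1)[OF deg \<open>q \<noteq> 0\<close>] by blast
    then show ?thesis by (intro exI[of _ "Suc k"]) (simp add: matrix_vector_mult_funpow_add)
  next
    case False
    then have "poly_orbit C q v = 0" using assms(1) eq by blast
    then show ?thesis using Suc.hyps(1)[OF deg \<open>q \<noteq> 0\<close>] by blast
  qed
qed

text \<open>Coinciding iterates need a case of their own: as a set the orbit then has fewer members
  and may be independent, and the relation is the difference of two equal iterates.\<close>

lemma orbit_dependent:
  fixes v :: "'a::euclidean_space" and f :: "'a \<Rightarrow> 'a"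
  shows "\<exists>N c. (\<exists>i\<le>N. c i \<noteq> 0) \<and> (\<Sum>i\<le>N. c i *\<^sub>R (f ^^ i) v) = 0"
proof -
  let ?N = "DIM('a)" let ?g = "\<lambda>i. (f ^^ i) v"
  show ?thesis
  proof (cases "inj_on ?g {..?N}")
    case True
    then have "dependent (?g ` {..?N})"
      by (intro dependent_biggerset) (simp add: card_image)
    then obtain u where u: "\<exists>w\<in>?g ` {..?N}. u w \<noteq> 0" "(\<Sum>w\<in>?g ` {..?N}. u w *\<^sub>R w) = 0"
      by (auto simp: dependent_finite)
    from u(2) have "(\<Sum>i\<le>?N. u (?g i) *\<^sub>R ?g i) = 0"
      using sum.reindex[OF True, of "\<lambda>w. u w *\<^sub>R w"] by (simp add: o_def)
    with u(1) show ?thesis by (intro exI[of _ ?N] exI[of _ "\<lambda>i. u (?g i)"]) auto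
  next
    case False
    then obtain i j where ij: "i \<le> ?N" "j \<le> ?N" "i \<noteq> j" "?g i = ?g j" by (auto simp: inj_on_def)
    let ?c = "\<lambda>k. if k = i then 1 else if k = j then - 1 else (0::real)"
    have "(\<Sum>k\<le>?N. ?c k *\<^sub>R ?g k) = (\<Sum>k\<in>{i, j}. ?c k *\<^sub>R ?g k)"
      using ij by (intro sum.mono_neutral_right) auto
    also have "\<dots> = 0" using ij by simp
    finally show ?thesis using ij by (intro exI[of _ ?N] exI[of _ ?c]) auto
  qed
qed

lemma linear_matrix_funpow: "linear ((*v) M ^^ j)" for M :: "real^'n^'n"
proof (induction j)
  case 0
  show ?case by (simp add: linear_iff)
next
  case (Suc j)
  show ?case unfolding funpow.simps by (rule linear_compose[OF Suc]) simp
qed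

text \<open>Each real vector has an annihilating polynomial by linear dependence of its orbit; over
  the complex numbers this polynomial can be stripped down to a power of \<open>X\<close>. This
  gives an exponent for each vector, made uniform on the standard basis.\<close>

lemma nilpotent_if_eigenvalues_zero:
  fixes A :: "real^'n^'n"
  assumes "\<forall>z. eigenvalue A z \<longrightarrow> z = 0"
  shows "\<exists>k. \<forall>v. ((*v) A ^^ k) v = 0"
proof -
  define C where "C = map_matrix complex_of_real A"
  define cv where "cv = (\<lambda>v::real^'n. \<chi> i. complex_of_real (v $ i))"
  have cv_A: "C *v cv v = cv (A *v v)" for v
    by (simp add: C_def cv_def vec_eq_iff matrix_vector_mult_def map_matrix_def)
  have cv_pow: "((*v) C ^^ k) (cv v) = cv (((*v) A ^^ k) v)" for k v
    by (induction k) (simp_all add: cv_A)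
  have cv_sum: "cv (\<Sum>i\<in>I. f i) = (\<Sum>i\<in>I. cv (f i))" for f and I :: "nat set"
    by (simp add: cv_def vec_eq_iff)
  have cv_0: "cv v = 0 \<longleftrightarrow> v = 0" for v by (simp add: cv_def vec_eq_iff)
  have cv_scale: "cv (c *\<^sub>R v) = complex_of_real c *s cv v" for c v
    by (simp add: cv_def vec_eq_iff)
  have ev: "C *v w = z *s w \<Longrightarrow> w \<noteq> 0 \<Longrightarrow> z = 0" for z w
    using assms unfolding eigenvalue_def C_def by blast
  have "\<exists>k. ((*v) A ^^ k) v = 0" for v
  proof -
    obtain N c where c: "\<exists>i\<le>N. c i \<noteq> 0" "(\<Sum>i\<le>N. c i *\<^sub>R ((*v) A ^^ i) v) = 0"
      using orbit_dependent by blast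
    define p where "p = (\<Sum>i\<le>N. monom (complex_of_real (c i)) i)"
    have coeff_p: "coeff p i = (if i \<le> N then complex_of_real (c i) else 0)" for i
      by (simp add: p_def coeff_sum if_distrib cong: if_cong)
    have "degree p \<le> N" by (rule degree_le) (simp add: coeff_p)
    moreover have "p \<noteq> 0" using c(1) coeff_p by (metis coeff_0 of_real_eq_0_iff)
    moreover have "(\<Sum>i\<le>N. coeff p i *s ((*v) C ^^ i) (cv v)) = 0"
      using arg_cong[OF c(2), of cv] by (simp add: coeff_p cv_sum cv_scale cv_pow cv_0)
    ultimately obtain k where "((*v) C ^^ k) (cv v) = 0"
      using poly_orbit_zero_imp_nilpotent[of C p "cv v"] ev by (auto simp: poly_orbit_bound)
    then show ?thesis by (auto simp: cv_pow cv_0)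
  qed
  then obtain k where k: "((*v) A ^^ k v) v = 0" for v by metis
  \<comment> \<open>Summing the exponents of the basis vectors is a cheap common upper bound for
    them.\<close>
  define K where "K = (\<Sum>i\<in>UNIV. k (axis i 1))"
  note lin = linear_matrix_funpow
  have zero: "((*v) A ^^ (j + k v)) v = 0" for j v
    using k[of v] linear_0[OF lin] by (simp add: funpow_add)
  have "((*v) A ^^ K) (axis i 1) = 0" for i
  proof -
    have "k (axis i 1) \<le> K" unfolding K_def by (rule member_le_sum) auto
    then show ?thesis using zero[of "K - k (axis i 1)" "axis i 1"] by simp
  qed
  note axis_0 = this
  have "((*v) A ^^ K) v = 0" for v
  proof -
    have "((*v) A ^^ K) v = (\<Sum>i\<in>UNIV. v $ i *\<^sub>R ((*v) A ^^ K) (axis i 1))"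
  proof -
    have "v = (\<Sum>i\<in>UNIV. v $ i *\<^sub>R axis i 1)"
      by (metis (no_types, lifting) basis_expansion scalar_mult_eq_scaleR sum.cong)
    then have "((*v) A ^^ K) v = ((*v) A ^^ K) (\<Sum>i\<in>UNIV. v $ i *\<^sub>R axis i 1)" by simp
    also have "\<dots> = (\<Sum>i\<in>UNIV. ((*v) A ^^ K) (v $ i *\<^sub>R axis i 1))" by (rule linear_sum[OF lin])
    finally show ?thesis by (simp only: linear_cmul[OF lin])
  qed
    then show ?thesis unfolding axis_0 by simp
  qed
  then show ?thesis by blast
qed

declare transpose_matrix_vector [simp del]

lemma inner_matrix_transpose: "(transpose A *v x) \<bullet> y = x \<bullet> (A *v y)" for A :: "real^'m^'n"
  by (metis dot_lmul_matrix transpose_matrix_vector)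

lemma inner_transpose_matrix: "(A *v x) \<bullet> y = x \<bullet> (transpose A *v y)" for A :: "real^'m^'n"
  by (metis inner_matrix_transpose transpose_transpose)

lemma scaleR_matrix_vector_mult: "(c *\<^sub>R M) *v v = c *\<^sub>R (M *v v)" for M :: "real^'m^'n"
  by (simp add: matrix_vector_mult_def vec_eq_iff sum_distrib_left mult.assoc)

lemma uminus_matrix_vector_mult: "(- M) *v v = - (M *v v)" for M :: "real^'m^'n"
  by (simp add: matrix_vector_mult_def vec_eq_iff sum_negf)

lemma sum_matrix_vector_mult: "(\<Sum>i\<in>I. M i) *v v = (\<Sum>i\<in>I. M i *v v)" for M :: "'i \<Rightarrow> real^'m^'n"
  by (induction I rule: infinite_finite_induct) (auto simp: matrix_vector_mult_add_rdistrib)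

lemma norm_le_of_inner:
  assumes "x \<bullet> x \<le> c * norm x" "0 \<le> c"
  shows "norm x \<le> (c::real)"
  using assms by (cases "x = 0") (auto simp: dot_square_norm power2_eq_square)


section \<open>Seminorms of positive semidefinite matrices\<close>

text \<open>Semidefinite rather than definite, since the seminorm is also taken for differences
  \<open>W g1 - W g2\<close>, which may degenerate.\<close>

definition psd :: "real^'n^'n \<Rightarrow> bool" where
  "psd D \<longleftrightarrow> transpose D = D \<and> (\<forall>v. 0 \<le> v \<bullet> (D *v v))"

definition qnorm :: "real^'n^'n \<Rightarrow> real^'n \<Rightarrow> real" where
  "qnorm D v = sqrt (v \<bullet> (D *v v))"

lemma psd_sym: "psd D \<Longrightarrow> u \<bullet> (D *v v) = v \<bullet> (D *v u)"
  by (metis inner_commute inner_matrix_transpose psd_def)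

lemma qnorm_nonneg [simp]: "psd D \<Longrightarrow> 0 \<le> qnorm D v"
  by (simp add: qnorm_def psd_def)

lemma qnorm_power2: "psd D \<Longrightarrow> (qnorm D v)\<^sup>2 = v \<bullet> (D *v v)"
  by (simp add: qnorm_def psd_def)

lemma qnorm_0 [simp]: "qnorm D 0 = 0"
  by (simp add: qnorm_def)

lemma qnorm_scaleR: "qnorm D (c *\<^sub>R v) = \<bar>c\<bar> * qnorm D v"
  by (simp add: qnorm_def matrix_vector_mult_scaleR real_sqrt_mult flip: mult.assoc)

lemma qnorm_cauchy_schwarz:
  assumes "psd D"
  shows "\<bar>u \<bullet> (D *v v)\<bar> \<le> qnorm D u * qnorm D v"
proof -
  have "0 \<le> (u + t *\<^sub>R v) \<bullet> (D *v (u + t *\<^sub>R v))" for t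
    using assms by (simp add: psd_def)
  then have *: "0 \<le> u \<bullet> (D *v u) + 2 * t * (u \<bullet> (D *v v)) + t\<^sup>2 * (v \<bullet> (D *v v))" for t
    by (simp add: matrix_vector_right_distrib matrix_vector_mult_scaleR inner_add
        psd_sym[OF assms, of v u] power2_eq_square algebra_simps)
  let ?a = "u \<bullet> (D *v u)" and ?b = "u \<bullet> (D *v v)" and ?c = "v \<bullet> (D *v v)"
  have c0: "0 \<le> ?c" using assms by (simp add: psd_def)
  have "?b\<^sup>2 \<le> ?a * ?c"
  proof (cases "?c = 0")
    case True
    have "?b = 0"
    proof (rule ccontr)
      assume "?b \<noteq> 0"
      \<comment> \<open>For \<open>?c = 0\<close> the quadratic is affine in \<open>t\<close>, and
        this \<open>t\<close> gives it the value -1.\<close>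
      with *[of "- (?a + 1) / (2 * ?b)"] True show False by (simp add: field_simps)
    qed
    then show ?thesis using True by simp
  next
    case False
    then have "0 < ?c" using c0 by simp
    have "0 \<le> ?c * (?a + 2 * (- ?b / ?c) * ?b + (- ?b / ?c)\<^sup>2 * ?c)"
      using *[of "- ?b / ?c"] c0 by (rule mult_nonneg_nonneg[rotated])
    also have "\<dots> = ?a * ?c - ?b\<^sup>2" using False by (simp add: field_simps power2_eq_square)
    finally show ?thesis by simp
  qed
  then have "sqrt (?b\<^sup>2) \<le> sqrt (?a * ?c)" by (rule real_sqrt_le_mono)
  then show ?thesis by (simp add: qnorm_def real_sqrt_mult)
qed

lemma qnorm_triangle:
  assumes "psd D"
  shows "qnorm D (u + v) \<le> qnorm D u + qnorm D v"
proof (rule power2_le_imp_le)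
  have "(qnorm D (u + v))\<^sup>2 = (qnorm D u)\<^sup>2 + 2 * (u \<bullet> (D *v v)) + (qnorm D v)\<^sup>2"
    using assms by (simp add: qnorm_power2 matrix_vector_right_distrib inner_add psd_sym[OF assms, of v u])
  also have "\<dots> \<le> (qnorm D u + qnorm D v)\<^sup>2"
    using qnorm_cauchy_schwarz[OF assms, of u v] by (simp add: power2_sum)
  finally show "(qnorm D (u + v))\<^sup>2 \<le> (qnorm D u + qnorm D v)\<^sup>2" .
qed (use assms in simp)

lemma qnorm_minus: "qnorm D (- v) = qnorm D v"
  using qnorm_scaleR[of D "-1" v] by simp

lemma qnorm_triangle_diff: "psd D \<Longrightarrow> qnorm D (u - v) \<le> qnorm D u + qnorm D v"
  using qnorm_triangle[of D u "- v"] by (simp add: qnorm_minus)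

lemma qnorm_mono:
  "u \<bullet> (D *v u) \<le> v \<bullet> (E *v v) \<Longrightarrow> qnorm D u \<le> qnorm E v"
  by (simp add: qnorm_def)


section \<open>The Lyapunov operator of a nilpotent matrix\<close>

definition lyap :: "real^'n^'n \<Rightarrow> real \<Rightarrow> real^'n^'n \<Rightarrow> real^'n^'n" where
  "lyap A g D = g *\<^sub>R D + A ** D + D ** transpose A"

lemma lyap_form:
  "u \<bullet> (lyap A g D *v v)
     = g * (u \<bullet> (D *v v)) + (transpose A *v u) \<bullet> (D *v v) + u \<bullet> (D *v (transpose A *v v))"
  by (simp add: lyap_def matrix_vector_mult_add_rdistrib inner_add inner_matrix_transpose
      scaleR_matrix_vector_mult matrix_vector_mul_assoc)

lemma linear_lyap: "linear (lyap A g)"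
proof (rule linearI)
  have rdistrib: "(X + Y) ** Z = X ** Z + Y ** Z" for X Y Z :: "real^'n^'n"
    by (simp add: matrix_matrix_mult_def vec_eq_iff distrib_right sum.distrib)
  show "lyap A g (D + E) = lyap A g D + lyap A g E" for D E
    by (simp add: lyap_def matrix_add_ldistrib rdistrib scaleR_right_distrib)
  show "lyap A g (c *\<^sub>R D) = c *\<^sub>R lyap A g D" for c D
    by (simp add: lyap_def scaleR_right_distrib matrix_scalar_ac mult.commute flip: scalar_matrix_assoc)
qed

lemma transpose_lyap: "transpose (lyap A g D) = lyap A g (transpose D)"
proof -
  have add: "transpose (X + Y) = transpose X + transpose Y" for X Y :: "real^'n^'n"
    by (simp add: transpose_def vec_eq_iff)
  show ?thesis
    by (simp add: lyap_def add transpose_scalar matrix_transpose_mul algebra_simps)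
qed

text \<open>
  With \<open>T = transpose A\<close> and \<open>R = (I + T/g)\<^sup>-\<^sup>1\<close>, the equation \<open>lyap A g D = Q\<close> becomes the Stein equation
  \<open>d(v) = q(R v)/g + d(T R v/g)\<close> between bilinear forms. As \<open>T\<close> is nilpotent, it unwinds in finitely
  many steps, so all facts below are inductions along the kernels of the powers of \<open>T\<close>.
\<close>

lemma stein_form:
  assumes "g \<noteq> 0" and u: "u = u' + (1 / g) *\<^sub>R (transpose A *v u')"
    and v: "v = v' + (1 / g) *\<^sub>R (transpose A *v v')"
  shows "u \<bullet> (D *v v) = u' \<bullet> (lyap A g D *v v') / g
    + ((1 / g) *\<^sub>R (transpose A *v u')) \<bullet> (D *v ((1 / g) *\<^sub>R (transpose A *v v')))"
  using assms(1) unfolding u v lyap_form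
  by (simp add: matrix_vector_right_distrib inner_add matrix_vector_mult_scaleR field_simps)

text \<open>This is the finite Neumann series of \<open>(I + T/g)^-1\<close> on the kernel of
  \<open>T^k\<close>. The seminorm bound is part of the statement, quantified over all
  \<open>Z\<close> and \<kappa>, because the witness is only known to exist.\<close>

lemma resolvent_exists:
  fixes A :: "real^'n^'n"
  assumes "g > 0" and "((*v) (transpose A) ^^ k) v = 0"
  shows "\<exists>v'. v = v' + (1 / g) *\<^sub>R (transpose A *v v') \<and> ((*v) (transpose A) ^^ k) v' = 0 \<and>
     (\<forall>Z \<kappa>. psd Z \<longrightarrow> 0 \<le> \<kappa> \<longrightarrow> (\<forall>u. qnorm Z (transpose A *v u) \<le> \<kappa> * g * qnorm Z u) \<longrightarrow>
        qnorm Z v' \<le> (1 + \<kappa>) ^ k * qnorm Z v)"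
  using assms(2)
proof (induction k arbitrary: v)
  case 0
  then show ?case by (intro exI[of _ 0]) simp
next
  case (Suc k)
  let ?T = "(*v) (transpose A)"
  note lin = linear_matrix_funpow
  have "(?T ^^ k) (?T v) = 0" using Suc.prems by (simp add: funpow_swap1)
  from Suc.IH[OF this] obtain w where
    w: "?T v = w + (1 / g) *\<^sub>R ?T w" "(?T ^^ k) w = 0"
      "\<And>Z \<kappa>. psd Z \<Longrightarrow> 0 \<le> \<kappa> \<Longrightarrow> (\<And>u. qnorm Z (?T u) \<le> \<kappa> * g * qnorm Z u) \<Longrightarrow>
        qnorm Z w \<le> (1 + \<kappa>) ^ k * qnorm Z (?T v)"
    by blast
  \<comment> \<open>With \<open>R = (I + T/g)^-1\<close> and \<open>w = R T v\<close>, this is the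
    identity \<open>R v = v - R T v / g\<close>.\<close>
  define v' where "v' = v - (1 / g) *\<^sub>R w"
  have "v' + (1 / g) *\<^sub>R ?T v' = v - (1 / g) *\<^sub>R (w + (1 / g) *\<^sub>R ?T w - ?T v)"
    by (simp add: v'_def matrix_vector_mult_diff_distrib matrix_vector_mult_scaleR algebra_simps)
  then have 1: "v = v' + (1 / g) *\<^sub>R ?T v'" using w(1) by simp
  have "(?T ^^ Suc k) w = 0" using w(2) by simp
  then have 2: "(?T ^^ Suc k) v' = 0"
    unfolding v'_def linear_diff[OF lin] linear_cmul[OF lin] Suc.prems by simp
  have "qnorm Z v' \<le> (1 + \<kappa>) ^ Suc k * qnorm Z v"
    if Z: "psd Z" "0 \<le> \<kappa>" "\<And>u. qnorm Z (?T u) \<le> \<kappa> * g * qnorm Z u" for Z \<kappa>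
  proof -
    have "qnorm Z v' \<le> qnorm Z v + (1 / g) * qnorm Z w"
      unfolding v'_def using qnorm_triangle_diff[OF Z(1), of v "(1 / g) *\<^sub>R w"] assms(1)
      by (simp add: qnorm_scaleR)
    also have "\<dots> \<le> qnorm Z v + (1 / g) * ((1 + \<kappa>) ^ k * (\<kappa> * g * qnorm Z v))"
    proof -
      have "qnorm Z w \<le> (1 + \<kappa>) ^ k * qnorm Z (?T v)" by (rule w(3)[OF Z])
      also have "\<dots> \<le> (1 + \<kappa>) ^ k * (\<kappa> * g * qnorm Z v)"
        using Z(2,3) by (intro mult_left_mono) auto
      finally show ?thesis using assms(1) by (intro add_left_mono mult_left_mono) auto
    qed
    also have "\<dots> = qnorm Z v * (1 + \<kappa> * (1 + \<kappa>) ^ k)" using assms(1) by (simp add: field_simps)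
    also have "\<dots> \<le> qnorm Z v * (1 + \<kappa>) ^ Suc k"
      using Z(1,2) one_le_power[of "1 + \<kappa>" k] by (intro mult_left_mono) (auto simp: algebra_simps)
    finally show ?thesis by (simp add: mult.commute)
  qed
  with 1 2 show ?case by blast
qed

text \<open>The argument of the recursive term in the Stein equation lies one kernel lower, so the
  unwinding stops.\<close>

lemma resolvent_shift:
  fixes A :: "real^'n^'n"
  assumes "((*v) (transpose A) ^^ Suc k) v = 0"
  shows "((*v) (transpose A) ^^ k) ((1 / g) *\<^sub>R (transpose A *v v)) = 0"
proof -
  have "((*v) (transpose A) ^^ k) (c *\<^sub>R w) = c *\<^sub>R ((*v) (transpose A) ^^ k) w" for c w
    by (induction k) (simp_all add: matrix_vector_mult_scaleR)
  then show ?thesis using assms by (simp add: funpow_swap1)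
qed

lemma lyap_zero_imp_form_zero:
  assumes "g > 0" and "lyap A g D = 0"
    and "((*v) (transpose A) ^^ k) u = 0" and "((*v) (transpose A) ^^ k) v = 0"
  shows "u \<bullet> (D *v v) = 0"
  using assms(3,4)
proof (induction k arbitrary: u v)
  case (Suc k)
  from resolvent_exists[OF assms(1) Suc.prems(1)] obtain u' where
    u: "u = u' + (1 / g) *\<^sub>R (transpose A *v u')" "((*v) (transpose A) ^^ Suc k) u' = 0" by blast
  from resolvent_exists[OF assms(1) Suc.prems(2)] obtain v' where
    v: "v = v' + (1 / g) *\<^sub>R (transpose A *v v')" "((*v) (transpose A) ^^ Suc k) v' = 0" by blast
  show ?case
    using stein_form[OF _ u(1) v(1), of D] assms(1,2)
      Suc.IH[OF resolvent_shift[OF u(2), of g] resolvent_shift[OF v(2), of g]] by simp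
qed simp

text \<open>Every term produced by unwinding the Stein equation is a nonnegative value of the
  right-hand side.\<close>

lemma lyap_psd_form:
  assumes "g > 0" and "\<And>v. 0 \<le> v \<bullet> (lyap A g D *v v)" and "((*v) (transpose A) ^^ k) v = 0"
  shows "0 \<le> v \<bullet> (D *v v)"
  using assms(3)
proof (induction k arbitrary: v)
  case (Suc k)
  from resolvent_exists[OF assms(1) Suc.prems] obtain v' where
    v: "v = v' + (1 / g) *\<^sub>R (transpose A *v v')" "((*v) (transpose A) ^^ Suc k) v' = 0" by blast
  show ?case
    using stein_form[OF _ v(1) v(1), of D] Suc.IH[OF resolvent_shift[OF v(2), of g]] assms(1) assms(2)[of v']
    by simp
qed simp

text \<open>Each unwinding step costs \<open>(1 + \<kappa>)^(2 n)\<close> for the resolvent, with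
  \<open>n\<close> a bound for all orders \<open>k\<close> that occur, and
  \<open>(1 + \<kappa>)^2\<close> for adding the recursive term. \<open>Z\<close> stays free: it
  will be another \<open>W\<close> in one use and a multiple of the identity in the other.\<close>

lemma lyap_form_upper_bound:
  assumes "g > 0" "psd Z" "0 \<le> \<kappa>"
    and Q: "\<And>v. v \<bullet> (lyap A g D *v v) \<le> (qnorm Z v)\<^sup>2"
    and T: "\<And>v. qnorm Z (transpose A *v v) \<le> \<kappa> * g * qnorm Z v"
    and "((*v) (transpose A) ^^ k) v = 0" "k \<le> n"
  shows "v \<bullet> (D *v v) \<le> ((1 + \<kappa>) ^ (2 * (n + 1))) ^ k / g * (qnorm Z v)\<^sup>2"
  using assms(6,7)
proof (induction k arbitrary: v)
  case (Suc k)
  define c where "c = ((1 + \<kappa>) ^ (2 * (n + 1))) ^ k"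
  have c1: "1 \<le> c" using \<open>0 \<le> \<kappa>\<close> unfolding c_def by (intro one_le_power) simp
  from resolvent_exists[OF assms(1) Suc.prems(1)] obtain v' where
    v: "v = v' + (1 / g) *\<^sub>R (transpose A *v v')" "((*v) (transpose A) ^^ Suc k) v' = 0"
       "qnorm Z v' \<le> (1 + \<kappa>) ^ Suc k * qnorm Z v" using assms(2,3) T by blast
  let ?m = "(1 / g) *\<^sub>R (transpose A *v v')"
  have "qnorm Z ?m \<le> \<kappa> * qnorm Z v'"
    using T[of v'] assms(1) by (simp add: qnorm_scaleR field_simps)
  then have m: "(qnorm Z ?m)\<^sup>2 \<le> \<kappa>\<^sup>2 * (qnorm Z v')\<^sup>2"
    using power_mono[of "qnorm Z ?m" "\<kappa> * qnorm Z v'" 2] assms(2) by (simp add: power_mult_distrib)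
  have "(1 + \<kappa>) ^ Suc k * qnorm Z v \<le> (1 + \<kappa>) ^ n * qnorm Z v"
    using assms(2,3) Suc.prems(2) by (intro mult_right_mono power_increasing) auto
  then have "qnorm Z v' \<le> (1 + \<kappa>) ^ n * qnorm Z v" using v(3) by linarith
  then have v': "(qnorm Z v')\<^sup>2 \<le> ((1 + \<kappa>) ^ n)\<^sup>2 * (qnorm Z v)\<^sup>2"
    using power_mono[of "qnorm Z v'" "(1 + \<kappa>) ^ n * qnorm Z v" 2] assms(2)
    by (simp only: power_mult_distrib qnorm_nonneg)
  have "v \<bullet> (D *v v) = v' \<bullet> (lyap A g D *v v') / g + ?m \<bullet> (D *v ?m)"
    using stein_form[OF _ v(1) v(1), of D] assms(1) by simp
  also have "v' \<bullet> (lyap A g D *v v') / g \<le> (qnorm Z v')\<^sup>2 / g"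
    using Q assms(1) by (simp add: divide_right_mono)
  also have "?m \<bullet> (D *v ?m) \<le> c / g * (qnorm Z ?m)\<^sup>2"
    unfolding c_def using Suc.prems(2) by (intro Suc.IH[OF resolvent_shift[OF v(2)]]) simp
  also have "\<dots> \<le> c / g * (\<kappa>\<^sup>2 * (qnorm Z v')\<^sup>2)"
    using m c1 assms(1) by (intro mult_left_mono) auto
  finally have "v \<bullet> (D *v v) \<le> (1 + c * \<kappa>\<^sup>2) / g * (qnorm Z v')\<^sup>2"
    using assms(1) by (simp add: field_simps)
  also have "\<dots> \<le> (c * (1 + \<kappa>)\<^sup>2) / g * (qnorm Z v')\<^sup>2"
  proof -
    have "1 + c * \<kappa>\<^sup>2 \<le> c * (1 + \<kappa>)\<^sup>2"
      using c1 assms(3) by (auto simp: power2_sum algebra_simps intro!: add_increasing2)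
    then show ?thesis using assms(1) by (intro mult_right_mono divide_right_mono) auto
  qed
  also have "\<dots> \<le> (c * (1 + \<kappa>)\<^sup>2) / g * (((1 + \<kappa>) ^ n)\<^sup>2 * (qnorm Z v)\<^sup>2)"
    using v' c1 assms(1) by (intro mult_left_mono) auto
  also have "\<dots> = ((1 + \<kappa>) ^ (2 * (n + 1))) ^ Suc k / g * (qnorm Z v)\<^sup>2"
    by (simp add: c_def power_add power_mult power2_eq_square mult.assoc power_mult_distrib power_even_eq algebra_simps)
  finally show ?case .
qed simp

text \<open>Let \<open>m = T R v / g\<close>. The Stein equation with a nonnegative right-hand side
  gives \<open>|m| \<le> |v|\<close>, and \<open>T v / g = m + T m / g\<close> with \<open>m\<close>
  of lower order. So each order adds only 1, and the factor is \<open>k\<close> instead of an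
  exponential in \<open>k\<close>.\<close>

lemma lyap_T_bound_aux:
  assumes "g > 0" "psd D" "\<And>v. 0 \<le> v \<bullet> (lyap A g D *v v)" "((*v) (transpose A) ^^ k) v = 0"
  shows "qnorm D ((1 / g) *\<^sub>R (transpose A *v v)) \<le> real k * qnorm D v"
  using assms(4)
proof (induction k arbitrary: v)
  case (Suc k)
  from resolvent_exists[OF assms(1) Suc.prems] obtain v' where
    v: "v = v' + (1 / g) *\<^sub>R (transpose A *v v')" "((*v) (transpose A) ^^ Suc k) v' = 0" by blast
  let ?m = "(1 / g) *\<^sub>R (transpose A *v v')"
  have "v \<bullet> (D *v v) = v' \<bullet> (lyap A g D *v v') / g + ?m \<bullet> (D *v ?m)"
    using stein_form[OF _ v(1) v(1), of D] assms(1) by simp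
  then have mv: "qnorm D ?m \<le> qnorm D v"
    using assms(1) assms(3)[of v'] by (intro qnorm_mono) simp
  have "(1 / g) *\<^sub>R (transpose A *v v) = ?m + (1 / g) *\<^sub>R (transpose A *v ?m)"
    by (subst v(1)) (simp add: matrix_vector_right_distrib scaleR_right_distrib)
  then have "qnorm D ((1 / g) *\<^sub>R (transpose A *v v)) \<le> qnorm D ?m + real k * qnorm D ?m"
    using qnorm_triangle[OF assms(2), of ?m "(1 / g) *\<^sub>R (transpose A *v ?m)"]
      Suc.IH[OF resolvent_shift[OF v(2), of g]] by simp
  also have "\<dots> \<le> qnorm D v + real k * qnorm D v"
    using mv by (intro add_mono mult_left_mono) auto
  finally show ?case by (simp add: algebra_simps)
qed simp

lemma lyap_T_bound:
  assumes "g > 0" "psd D" "\<And>v. 0 \<le> v \<bullet> (lyap A g D *v v)" "((*v) (transpose A) ^^ k) v = 0"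
  shows "qnorm D (transpose A *v v) \<le> real k * g * qnorm D v"
  using lyap_T_bound_aux[OF assms] assms(1) by (simp add: qnorm_scaleR field_simps)


section \<open>The parametric Lyapunov equation\<close>

text \<open>For such a \<open>w\<close> the product \<open>w \<bullet> x\<close> is constant along
  every trajectory; steering from 0 to \<open>w\<close> gives \<open>w \<bullet> w = 0\<close>. When
  0 is the only eigenvalue, this is the Hautus test.\<close>

lemma controllable_imp_no_common_kernel:
  assumes "controllable A B" and "transpose A *v w = 0" and "transpose B *v w = 0"
  shows "w = 0"
proof -
  obtain T u x where T: "T > 0" "u absolutely_integrable_on {0..T}"
    "integral_curve (\<lambda>s. A *v x s + B *v u s) x T" "x 0 = 0" "x T = w"
    using assms(1) unfolding controllable_def by blast
  let ?f = "\<lambda>s. A *v x s + B *v u s"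
  have int: "?f integrable_on {0..T}" and xT: "w = integral {0..T} ?f"
    using T by (auto simp: integral_curve_def dest: set_lebesgue_integral_eq_integral)
  have "w \<bullet> w = integral {0..T} ((\<bullet>) w \<circ> ?f)"
    by (subst integral_linear[OF int bounded_linear_inner_right]) (simp flip: xT)
  also have "(\<bullet>) w \<circ> ?f = (\<lambda>s. 0)"
    using assms(2,3) by (auto simp: inner_add_right simp flip: inner_matrix_transpose)
  finally show ?thesis by simp
qed

text \<open>Here \<open>n\<close> is any exponent that annihilates \<open>A\<close>; the dimension
  is the size of the type \<open>'n\<close>.\<close>

locale nilpotent_pair =
  fixes A :: "real^'n^'n" and B :: "real^'m^'n" and n :: nat
  assumes nilpotent: "((*v) A ^^ n) v = 0"
    and no_common_kernel: "transpose A *v w = 0 \<Longrightarrow> transpose B *v w = 0 \<Longrightarrow> w = 0"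
begin

lemma nilpotent_transpose: "((*v) (transpose A) ^^ n) v = 0"
proof -
  have "((*v) (transpose A) ^^ k) v \<bullet> w = v \<bullet> ((*v) A ^^ k) w" for k v w
    by (induction k arbitrary: v) (simp_all add: funpow_swap1 inner_matrix_transpose)
  from this[of n v] show ?thesis by (metis nilpotent inner_eq_zero_iff inner_zero_right)
qed

lemma lyap_inject:
  assumes "g > 0" and "lyap A g D = lyap A g E"
  shows "D = E"
proof -
  have "lyap A g (D - E) = 0" using assms(2) by (simp add: linear_diff[OF linear_lyap])
  then have "u \<bullet> ((D - E) *v v) = 0" for u v
    using lyap_zero_imp_form_zero[OF assms(1) _ nilpotent_transpose nilpotent_transpose] by blast
  then have "(D - E) *v v = 0 *v v" for v by (metis inner_eq_zero_iff matrix_vector_mult_0)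
  then have "D - E = 0" using matrix_eq by blast
  then show ?thesis by simp
qed

definition W :: "real \<Rightarrow> real^'n^'n" where
  "W g = (SOME D. lyap A g D = B ** transpose B)"

definition P :: "real \<Rightarrow> real^'n^'n" where
  "P g = (SOME X. W g ** X = mat 1 \<and> X ** W g = mat 1)"

text \<open>Injectivity of a linear map on a finite-dimensional space gives surjectivity, so the
  choice in \<open>W\<close> picks the unique solution.\<close>

lemma lyap_W:
  assumes "g > 0"
  shows "lyap A g (W g) = B ** transpose B"
proof -
  have "inj (lyap A g)" using lyap_inject[OF assms] by (auto intro: injI)
  then have "surj (lyap A g)" by (rule linear_inj_imp_surj[OF linear_lyap])
  then have "\<exists>D. lyap A g D = B ** transpose B" by (metis surjD)
  then show ?thesis unfolding W_def by (rule someI_ex)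
qed

lemma lyap_W_form: "g > 0 \<Longrightarrow> v \<bullet> (lyap A g (W g) *v v) = (norm (transpose B *v v))\<^sup>2"
  by (simp add: lyap_W inner_matrix_transpose power2_norm_eq_inner flip: matrix_vector_mul_assoc)

lemma psd_W:
  assumes "g > 0"
  shows "psd (W g)"
  unfolding psd_def
proof
  \<comment> \<open>The right-hand side is symmetric, so the transpose solves the same equation and
    uniqueness applies.\<close>
  have "lyap A g (transpose (W g)) = lyap A g (W g)"
    unfolding transpose_lyap[symmetric] lyap_W[OF assms] by (simp add: matrix_transpose_mul)
  then show "transpose (W g) = W g" by (rule lyap_inject[OF assms])
  show "\<forall>v. 0 \<le> v \<bullet> (W g *v v)"
    using lyap_psd_form[OF assms _ nilpotent_transpose] by (simp add: lyap_W_form assms)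
qed

text \<open>If \<open>W v = 0\<close>, the quadratic form of the equation gives
  \<open>B^T v = 0\<close>, and testing the equation against arbitrary \<open>u\<close> gives
  \<open>W A^T v = 0\<close>. The kernel is therefore invariant under the nilpotent
  \<open>A^T\<close>, and descending it ends in a common kernel vector.\<close>

lemma W_kernel:
  assumes "g > 0" and "W g *v v = 0"
  shows "v = 0"
proof -
  have "W g *v v = 0 \<Longrightarrow> ((*v) (transpose A) ^^ k) v = 0 \<Longrightarrow> v = 0" for k
  proof (induction k arbitrary: v)
    case (Suc k)
    have "(norm (transpose B *v v))\<^sup>2 = 0"
      using Suc.prems(1) psd_sym[OF psd_W[OF assms(1)], of v "transpose A *v v"]
      unfolding lyap_W_form[OF assms(1), symmetric] lyap_form by simp
    then have Bv: "transpose B *v v = 0" by simp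
    have "u \<bullet> (W g *v (transpose A *v v)) = 0" for u
    proof -
      have "u \<bullet> (lyap A g (W g) *v v) = 0"
        using Bv by (simp add: lyap_W[OF assms(1)] flip: matrix_vector_mul_assoc)
      then show ?thesis using Suc.prems(1) by (simp add: lyap_form)
    qed
    then have "W g *v (transpose A *v v) = 0" by (metis inner_eq_zero_iff)
    then have "transpose A *v v = 0" using Suc.IH Suc.prems(2) by (simp add: funpow_swap1)
    then show ?case using Bv no_common_kernel by blast
  qed simp
  then show ?thesis using assms(2) nilpotent_transpose by blast
qed

lemma W_pos:
  assumes "g > 0" and "v \<noteq> 0"
  shows "0 < v \<bullet> (W g *v v)"
proof (rule ccontr)
  assume "\<not> ?thesis"
  then have "qnorm (W g) v = 0"
    using psd_W[OF assms(1)] by (auto simp: qnorm_def psd_def not_less intro: antisym)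
  then have "\<bar>(W g *v v) \<bullet> (W g *v v)\<bar> \<le> 0"
    using qnorm_cauchy_schwarz[OF psd_W[OF assms(1)], of "W g *v v" v] by (simp only: mult_zero_right)
  then have "W g *v v = 0" by (metis abs_le_zero_iff inner_eq_zero_iff)
  then show False using W_kernel assms by blast
qed

lemma invertible_W:
  assumes "g > 0"
  shows "invertible (W g)"
  using W_kernel[OF assms] by (metis invertible_left_inverse matrix_left_invertible_ker)

lemma W_P: "g > 0 \<Longrightarrow> W g ** P g = mat 1" and P_W: "g > 0 \<Longrightarrow> P g ** W g = mat 1"
proof -
  assume "g > 0"
  then have "\<exists>X. W g ** X = mat 1 \<and> X ** W g = mat 1"
    using invertible_W by (simp add: invertible_def)
  from someI_ex[OF this] show "W g ** P g = mat 1" "P g ** W g = mat 1"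
    unfolding P_def by auto
qed

lemma W_P_apply: "g > 0 \<Longrightarrow> W g *v (P g *v x) = x"
  and P_W_apply: "g > 0 \<Longrightarrow> P g *v (W g *v x) = x"
  by (simp_all add: matrix_vector_mul_assoc W_P P_W)

lemma transpose_P: "g > 0 \<Longrightarrow> transpose (P g) = P g"
proof -
  assume g: "g > 0"
  have "transpose (W g) = W g" using psd_W[OF g] by (simp add: psd_def)
  then have "transpose (P g) ** W g = mat 1"
    using arg_cong[OF W_P[OF g], of transpose] by (simp add: matrix_transpose_mul)
  then have "transpose (P g) ** (W g ** P g) = P g" by (simp add: matrix_mul_assoc)
  then show ?thesis by (simp add: W_P[OF g])
qed

lemma P_sym: "g > 0 \<Longrightarrow> u \<bullet> (P g *v v) = (P g *v u) \<bullet> v"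
  by (metis inner_matrix_transpose transpose_P)

lemma positive_definite_P:
  assumes "g > 0"
  shows "positive_definite (P g)"
  unfolding positive_definite_def
proof (intro conjI allI impI)
  fix v :: "real^'n"
  assume "v \<noteq> 0"
  then have "P g *v v \<noteq> 0" using W_P_apply[OF assms, of v] by auto
  then show "0 < v \<bullet> (P g *v v)"
    using W_pos[OF assms, of "P g *v v"] by (simp add: W_P_apply[OF assms] inner_commute)
qed (rule transpose_P[OF assms])

text \<open>Multiplying the linear equation by \<open>Y\<close> from both sides produces the
  quadratic one, and \<open>X\<close> undoes this.\<close>

lemma ple_inverse_iff:
  assumes "X ** Y = mat 1" and "Y ** X = mat 1"
  shows "transpose A ** Y + Y ** A - Y ** B ** transpose B ** Y = - (g *\<^sub>R Y) \<longleftrightarrow>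
    lyap A g X = B ** transpose B"
proof -
  have add: "(K + L) ** M = K ** M + L ** M" for K L M :: "real^'n^'n"
    by (simp add: matrix_matrix_mult_def vec_eq_iff distrib_right sum.distrib)
  have scale: "(c *\<^sub>R K) ** M = c *\<^sub>R (K ** M)" "K ** (c *\<^sub>R M) = c *\<^sub>R (K ** M)"
    for c and K M :: "real^'n^'n"
    by (simp_all add: matrix_scalar_ac scalar_matrix_assoc)
  have eq: "Y ** lyap A g X ** Y = g *\<^sub>R Y + Y ** A + transpose A ** Y"
    using assms
    by (simp add: lyap_def matrix_add_ldistrib add scale matrix_mul_assoc)
      (simp flip: matrix_mul_assoc)
  have "lyap A g X = B ** transpose B \<longleftrightarrow> Y ** lyap A g X ** Y = Y ** (B ** transpose B) ** Y"
  proof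
    assume "Y ** lyap A g X ** Y = Y ** (B ** transpose B) ** Y"
    then have "(X ** Y) ** lyap A g X ** (Y ** X) = (X ** Y) ** (B ** transpose B) ** (Y ** X)"
      by (metis matrix_mul_assoc)
    then show "lyap A g X = B ** transpose B" by (simp add: assms)
  qed simp
  also have "\<dots> \<longleftrightarrow> transpose A ** Y + Y ** A - Y ** B ** transpose B ** Y = - (g *\<^sub>R Y)"
    unfolding eq by (auto simp: matrix_mul_assoc algebra_simps eq_neg_iff_add_eq_0)
  finally show ?thesis ..
qed

text \<open>A positive definite solution is invertible and its inverse solves the linear equation,
  so uniqueness is inherited from there.\<close>

lemma ple_solution_eq_P:
  assumes "g > 0"
  shows "ple_solution A B g = P g"
  unfolding ple_solution_def
proof (rule the_equality)
  show "positive_definite (P g) \<and> transpose A ** P g + P g ** A - P g ** B ** transpose B ** P g = - (g *\<^sub>R P g)"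
    using positive_definite_P[OF assms] ple_inverse_iff[OF W_P[OF assms] P_W[OF assms]] lyap_W[OF assms] by blast
next
  fix Y
  assume Y: "positive_definite Y \<and> transpose A ** Y + Y ** A - Y ** B ** transpose B ** Y = - (g *\<^sub>R Y)"
  then have "Y *v v = 0 \<Longrightarrow> v = 0" for v
    unfolding positive_definite_def by (metis inner_zero_right less_irrefl)
  then have "invertible Y" by (metis invertible_left_inverse matrix_left_invertible_ker)
  then obtain X where inv: "Y ** X = mat 1" "X ** Y = mat 1" by (auto simp: invertible_def)
  have "lyap A g X = B ** transpose B"
    using Y ple_inverse_iff[OF inv(2) inv(1)] by blast
  then have "X = W g" using lyap_inject[OF assms] lyap_W[OF assms] by metis
  then have "Y ** W g = mat 1" using inv by simp
  then have "Y ** (W g ** P g) = P g" by (simp add: matrix_mul_assoc)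
  then show "Y = P g" by (simp add: W_P[OF assms])
qed


section \<open>Bounds for the solution as the parameter tends to zero\<close>

abbreviation wnorm :: "real \<Rightarrow> real^'n \<Rightarrow> real" where
  "wnorm g \<equiv> qnorm (W g)"

lemma wnorm_P: "g > 0 \<Longrightarrow> (wnorm g (P g *v x))\<^sup>2 = x \<bullet> (P g *v x)"
  by (simp add: qnorm_power2 psd_W W_P_apply inner_commute)

lemma wnorm_transpose_A: "g > 0 \<Longrightarrow> wnorm g (transpose A *v v) \<le> real n * g * wnorm g v"
  by (rule lyap_T_bound) (simp_all add: psd_W lyap_W_form nilpotent_transpose)

text \<open>The equation gives \<open>|B^T v|^2 = g |v|^2 + 2 <v, A^T v>\<close> in the inner
  product of \<open>W g\<close>, and the bound \<open>n g\<close> on \<open>A^T\<close> turns this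
  into at most \<open>(1 + 2 n) g |v|^2\<close>.\<close>

definition b :: real where "b = sqrt (1 + 2 * real n)"

lemma b_pos: "b > 0" by (simp add: b_def add_pos_nonneg)

lemma norm_transpose_B:
  assumes "g > 0"
  shows "norm (transpose B *v v) \<le> b * sqrt g * wnorm g v"
proof -
  have "(norm (transpose B *v v))\<^sup>2 = g * (wnorm g v)\<^sup>2 + 2 * (v \<bullet> (W g *v (transpose A *v v)))"
    using psd_sym[OF psd_W[OF assms], of v "transpose A *v v"]
    by (simp add: lyap_W_form[OF assms, symmetric] lyap_form qnorm_power2[OF psd_W[OF assms]])
  also have "v \<bullet> (W g *v (transpose A *v v)) \<le> wnorm g v * (real n * g * wnorm g v)"
    using qnorm_cauchy_schwarz[OF psd_W[OF assms], of v "transpose A *v v"]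
      mult_left_mono[OF wnorm_transpose_A[OF assms, of v] qnorm_nonneg[OF psd_W[OF assms], of v]]
    by linarith
  finally have "(norm (transpose B *v v))\<^sup>2 \<le> (b * sqrt g * wnorm g v)\<^sup>2"
    using assms by (simp add: b_def power_mult_distrib) (simp add: algebra_simps power2_eq_square)
  then show ?thesis
    by (rule power2_le_imp_le) (use assms b_pos psd_W in simp)
qed

text \<open>Dual to \<open>norm_transpose_B\<close>: the square of the left side is \<open>z\<close>
  paired with \<open>B^T\<close> of the same vector.\<close>

lemma wnorm_P_B:
  assumes "g > 0"
  shows "wnorm g (P g *v (B *v z)) \<le> b * sqrt g * norm z"
proof -
  let ?p = "P g *v (B *v z)"
  have "(wnorm g ?p)\<^sup>2 = z \<bullet> (transpose B *v ?p)"
    by (simp add: wnorm_P[OF assms] inner_transpose_matrix)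
  also have "\<dots> \<le> norm z * (b * sqrt g * wnorm g ?p)"
    using norm_cauchy_schwarz[of z "transpose B *v ?p"]
      mult_left_mono[OF norm_transpose_B[OF assms, of ?p] norm_ge_zero[of z]] by linarith
  finally have "wnorm g ?p * wnorm g ?p \<le> (b * sqrt g * norm z) * wnorm g ?p"
    by (simp add: power2_eq_square mult_ac)
  then show ?thesis
    using psd_W[OF assms] b_pos assms by (cases "wnorm g ?p = 0") (auto simp: mult_le_cancel_right order_less_le)
qed

text \<open>The sum is homogeneous and, by nilpotency and the trivial common kernel, vanishes only
  at 0; \<open>c\<close> is its minimum on the unit sphere.\<close>

lemma observability:
  "\<exists>c>0. \<forall>v. c * norm v \<le> (\<Sum>j<n. norm (transpose B *v (((*v) (transpose A) ^^ j) v)))"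
proof -
  let ?T = "(*v) (transpose A)"
  let ?f = "\<lambda>v. \<Sum>j<n. norm (transpose B *v ((?T ^^ j) v))"
  note lin = linear_matrix_funpow
  have scale: "?f (r *\<^sub>R v) = \<bar>r\<bar> * ?f v" for r v
    by (simp add: linear_cmul[OF lin] matrix_vector_mult_scaleR sum_distrib_left)
  have pos: "0 < ?f v" if "v \<noteq> 0" for v
  proof (rule ccontr)
    assume "\<not> ?thesis"
    then have "?f v = 0" by (simp add: sum_nonneg order_antisym not_less)
    then have z: "\<forall>j<n. transpose B *v ((?T ^^ j) v) = 0"
      by (simp add: sum_nonneg_eq_0_iff)
    have "(?T ^^ k) v = 0 \<Longrightarrow> \<forall>j<k. transpose B *v ((?T ^^ j) v) = 0 \<Longrightarrow> v = 0" for k v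
    proof (induction k arbitrary: v)
      case (Suc k)
      have "?T v = 0"
      proof (rule Suc.IH)
        show "(?T ^^ k) (?T v) = 0" using Suc.prems(1) by (simp add: funpow_swap1)
        show "\<forall>j<k. transpose B *v ((?T ^^ j) (?T v)) = 0"
        proof (intro allI impI)
          fix j assume "j < k"
          then show "transpose B *v ((?T ^^ j) (?T v)) = 0"
            using Suc.prems(2)[rule_format, of "Suc j"] by (simp add: funpow_swap1)
        qed
      qed
      moreover have "transpose B *v v = 0" using Suc.prems(2)[rule_format, of 0] by simp
      ultimately show ?case by (rule no_common_kernel)
    qed simp
    from this[OF nilpotent_transpose z] \<open>v \<noteq> 0\<close> show False by blast
  qed
  have cont: "continuous_on (sphere 0 1) ?f"
  proof (intro continuous_intros)
    fix j
    show "continuous_on (sphere 0 1) (\<lambda>v. transpose B *v ((?T ^^ j) v))"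
      by (rule linear_continuous_on_compose[OF linear_continuous_on[OF linear_conv_bounded_linear[THEN iffD1, OF lin[of j]]]]) simp
  qed
  obtain e :: "real^'n" where e: "norm e = 1" by (metis vector_choose_size zero_le_one)
  then have "sphere (0::real^'n) 1 \<noteq> {}" by auto
  from continuous_attains_inf[OF compact_sphere this cont] obtain w where
    w: "norm w = 1" "\<And>v. norm v = 1 \<Longrightarrow> ?f w \<le> ?f v" by (auto simp: sphere_def)
  have "0 < ?f w" using pos[of w] w(1) by fastforce
  moreover have "?f w * norm v \<le> ?f v" for v
  proof (cases "v = 0")
    case True
    then show ?thesis by (simp add: sum_nonneg)
  next
    case False
    then have "?f w \<le> ?f ((1 / norm v) *\<^sub>R v)" by (intro w(2)) simp
    also have "\<dots> = ?f v / norm v" unfolding scale by simp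
    finally show ?thesis using False by (simp add: field_simps)
  qed
  ultimately show ?thesis by blast
qed

text \<open>Observability reduces the norm of \<open>v\<close> to the vectors
  \<open>B^T T^j v\<close>. Each of them carries a factor \<open>sqrt g\<close> from
  \<open>B^T\<close>, while the powers of \<open>T\<close> cost only \<open>(n g)^j\<close>, bounded
  in terms of \<open>g0\<close>.\<close>

lemma norm_le_wnorm:
  assumes "g0 > 0"
  shows "\<exists>C>0. \<forall>g v. 0 < g \<longrightarrow> g \<le> g0 \<longrightarrow> norm v \<le> C * sqrt g * wnorm g v"
proof -
  let ?T = "(*v) (transpose A)"
  obtain c where c: "c > 0" "\<And>v. c * norm v \<le> (\<Sum>j<n. norm (transpose B *v ((?T ^^ j) v)))"
    using observability by blast
  define S where "S = (\<Sum>j<n. (real n * g0) ^ j)"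
  have "norm v \<le> (b * (S + 1) / c) * sqrt g * wnorm g v" if g: "0 < g" "g \<le> g0" for g v
  proof -
    have *: "wnorm g ((?T ^^ j) v) \<le> (real n * g) ^ j * wnorm g v" for j
    proof (induction j)
      case (Suc j)
      have "wnorm g ((?T ^^ Suc j) v) \<le> real n * g * wnorm g ((?T ^^ j) v)"
        using wnorm_transpose_A[OF g(1)] by simp
      also have "\<dots> \<le> real n * g * ((real n * g) ^ j * wnorm g v)"
        using Suc g by (intro mult_left_mono) auto
      finally show ?case by simp
    qed simp
    have "c * norm v \<le> (\<Sum>j<n. b * sqrt g * ((real n * g0) ^ j * wnorm g v))"
    proof (rule order_trans[OF c(2)], rule sum_mono)
      fix j
      have "norm (transpose B *v ((?T ^^ j) v)) \<le> b * sqrt g * wnorm g ((?T ^^ j) v)"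
        by (rule norm_transpose_B[OF g(1)])
      also have "\<dots> \<le> b * sqrt g * ((real n * g) ^ j * wnorm g v)"
        using * b_pos g by (intro mult_left_mono) auto
      also have "\<dots> \<le> b * sqrt g * ((real n * g0) ^ j * wnorm g v)"
        using b_pos g psd_W[OF g(1)]
        by (intro mult_left_mono mult_right_mono power_mono) auto
      finally show "norm (transpose B *v ((?T ^^ j) v)) \<le> b * sqrt g * ((real n * g0) ^ j * wnorm g v)" .
    qed
    also have "\<dots> = b * sqrt g * S * wnorm g v"
      by (simp add: S_def sum_distrib_left sum_distrib_right mult_ac)
    also have "\<dots> \<le> b * sqrt g * (S + 1) * wnorm g v"
      using b_pos g psd_W[OF g(1)] by (intro mult_right_mono mult_left_mono) auto
    finally show ?thesis using c(1) by (simp add: field_simps)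
  qed
  moreover have "0 \<le> S" unfolding S_def using assms by (intro sum_nonneg) auto
  ultimately show ?thesis using b_pos c(1)
    by (intro exI[of _ "b * (S + 1) / c"]) auto
qed

section \<open>Dependence of \<open>W\<close> and \<open>P\<close> on the parameter\<close>

lemma lyap_W_diff: "g1 > 0 \<Longrightarrow> g2 > 0 \<Longrightarrow> lyap A g1 (W g1 - W g2) = (g2 - g1) *\<^sub>R W g2"
  using lyap_W[of g1] lyap_W[of g2]
  by (simp add: linear_diff[OF linear_lyap]) (simp add: lyap_def algebra_simps)

text \<open>The difference solves the \<open>g1\<close> equation with the semidefinite right-hand
  side \<open>(g2 - g1) W g2\<close>.\<close>

lemma psd_W_diff:
  assumes "0 < g1" "g1 \<le> g2"
  shows "psd (W g1 - W g2)"
  unfolding psd_def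
proof
  have "transpose (X - Y) = transpose X - transpose Y" for X Y :: "real^'n^'n"
    by (simp add: transpose_def vec_eq_iff)
  then show "transpose (W g1 - W g2) = W g1 - W g2"
    using psd_W[of g1] psd_W[of g2] assms by (simp add: psd_def)
  have "0 \<le> v \<bullet> (lyap A g1 (W g1 - W g2) *v v)" for v
    using psd_W[of g2] assms by (simp add: lyap_W_diff scaleR_matrix_vector_mult psd_def)
  then show "\<forall>v. 0 \<le> v \<bullet> ((W g1 - W g2) *v v)"
    using lyap_psd_form[OF assms(1) _ nilpotent_transpose] by blast
qed

lemma wnorm_antimono: "0 < g1 \<Longrightarrow> g1 \<le> g2 \<Longrightarrow> wnorm g2 v \<le> wnorm g1 v"
  using psd_W_diff[of g1 g2] by (intro qnorm_mono) (simp add: psd_def matrix_vector_mult_diff_rdistrib inner_diff_right)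

text \<open>The factor of \<open>lyap_form_upper_bound\<close> for \<open>\<kappa> = 2 n\<close> and
  \<open>k = n\<close>; this \<kappa> comes from \<open>n * g2 \<le> 2 * n * g1\<close>.\<close>

definition c\<^sub>W :: real where "c\<^sub>W = ((1 + 2 * real n) ^ (2 * (n + 1))) ^ n"

lemma c\<^sub>W_pos: "c\<^sub>W > 0" by (simp add: c\<^sub>W_def add_pos_nonneg)

lemma W_diff_upper:
  assumes "0 < g1" "g1 \<le> g2" "g2 \<le> 2 * g1"
  shows "v \<bullet> ((W g1 - W g2) *v v) \<le> c\<^sub>W * ((g2 - g1) / g1) * (wnorm g2 v)\<^sup>2"
proof (cases "g1 = g2")
  case False
  define r where "r = g2 - g1"
  have r: "r > 0" and g2: "g2 > 0" using False assms by (auto simp: r_def)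
  \<comment> \<open>The difference quotient has right-hand side exactly \<open>W g2\<close>, which
    then also serves as the reference seminorm \<open>Z\<close>.\<close>
  have l: "lyap A g1 ((1 / r) *\<^sub>R (W g1 - W g2)) = W g2"
    using r assms(1) g2 by (simp add: linear_cmul[OF linear_lyap] lyap_W_diff flip: r_def)
  have "v \<bullet> (((1 / r) *\<^sub>R (W g1 - W g2)) *v v) \<le> c\<^sub>W / g1 * (wnorm g2 v)\<^sup>2"
    unfolding c\<^sub>W_def
  proof (rule lyap_form_upper_bound[OF assms(1) psd_W[OF g2] _ _ _ nilpotent_transpose])
    show "u \<bullet> (lyap A g1 ((1 / r) *\<^sub>R (W g1 - W g2)) *v u) \<le> (wnorm g2 u)\<^sup>2" for u
      by (simp add: l qnorm_power2 psd_W g2)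
    fix u
    have "wnorm g2 (transpose A *v u) \<le> real n * g2 * wnorm g2 u" by (rule wnorm_transpose_A[OF g2])
    also have "\<dots> \<le> real n * (2 * g1) * wnorm g2 u"
      using assms psd_W[OF g2] by (intro mult_right_mono mult_left_mono) auto
    finally show "wnorm g2 (transpose A *v u) \<le> 2 * real n * g1 * wnorm g2 u" by (simp add: mult_ac)
  qed auto
  then show ?thesis
    using r assms(1) unfolding scaleR_matrix_vector_mult inner_scaleR_right r_def[symmetric]
    by (simp add: field_simps)
qed simp

text \<open>Write \<open>P g2 - P g1 = P g1 (W g1 - W g2) P g2\<close>, apply Cauchy-Schwarz in the
  seminorm of the middle factor, and bound that seminorm on both sides by
  \<open>W_diff_upper\<close>. The two vectors are measured at different parameters because they
  will belong to different times.\<close>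

lemma P_diff:
  assumes "0 < g1" "g1 \<le> g2" "g2 \<le> 2 * g1"
  shows "\<bar>u \<bullet> (P g2 *v x - P g1 *v x)\<bar>
    \<le> c\<^sub>W * ((g2 - g1) / g1) * wnorm g1 (P g1 *v u) * wnorm g2 (P g2 *v x)"
proof -
  have g2: "g2 > 0" using assms by simp
  let ?E = "W g1 - W g2" and ?p = "P g1 *v u" and ?y = "P g2 *v x"
  let ?s = "sqrt (c\<^sub>W * ((g2 - g1) / g1))"
  have pos: "0 \<le> c\<^sub>W * ((g2 - g1) / g1)" using c\<^sub>W_pos assms by simp
  have E: "qnorm ?E v \<le> ?s * wnorm g2 v" for v
  proof -
    have "qnorm ?E v \<le> sqrt (c\<^sub>W * ((g2 - g1) / g1) * (wnorm g2 v)\<^sup>2)"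
      unfolding qnorm_def[of ?E] by (rule real_sqrt_le_mono[OF W_diff_upper[OF assms]])
    also have "\<dots> = ?s * wnorm g2 v"
      using qnorm_nonneg[OF psd_W[OF g2], of v] by (simp only: real_sqrt_mult real_sqrt_abs abs_of_nonneg)
    finally show ?thesis .
  qed
  have "u \<bullet> (?y - P g1 *v x) = ?p \<bullet> (?E *v ?y)"
    using assms(1) g2
    by (simp add: matrix_vector_mult_diff_rdistrib inner_diff_right W_P_apply
        P_sym[symmetric] P_W_apply flip: P_sym)
  also have "\<bar>\<dots>\<bar> \<le> qnorm ?E ?p * qnorm ?E ?y"
    by (rule qnorm_cauchy_schwarz[OF psd_W_diff[OF assms(1,2)]])
  also have "\<dots> \<le> (?s * wnorm g2 ?p) * (?s * wnorm g2 ?y)"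
    using E psd_W_diff[OF assms(1,2)] psd_W[OF g2] pos by (intro mult_mono) auto
  also have "\<dots> = c\<^sub>W * ((g2 - g1) / g1) * wnorm g2 ?p * wnorm g2 ?y"
  proof -
    have ss: "?s * ?s = c\<^sub>W * ((g2 - g1) / g1)" using pos by (rule real_sqrt_mult_self[THEN trans, OF abs_of_nonneg])
    have "(s * p) * (s * y) = (s * s) * p * y" for s p y :: real by simp
    then show ?thesis using ss by (rule trans[OF _ arg_cong[where f = "\<lambda>r. r * _ * _"]])
  qed
  also have "\<dots> \<le> c\<^sub>W * ((g2 - g1) / g1) * wnorm g1 ?p * wnorm g2 ?y"
    using wnorm_antimono[OF assms(1,2), of ?p] pos psd_W[OF g2]
    by (intro mult_right_mono mult_left_mono) auto
  finally show ?thesis .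
qed

text \<open>A crude bound suffices, since only polynomial growth in \<open>1 / g\<close> matters. It
  is the general upper bound in a Euclidean seminorm, where \<open>A^T\<close> has relative size
  \<open>\<kappa> = a / g\<close>.\<close>

lemma W_upper:
  assumes "g0 > 0"
  shows "\<exists>C>0. \<exists>p::nat. \<forall>g v. 0 < g \<longrightarrow> g \<le> g0 \<longrightarrow> (norm (W g *v v))\<^sup>2 \<le> C * (1 / g) ^ p * (wnorm g v)\<^sup>2"
proof -
  obtain a where a: "a > 0" "\<And>v. norm (transpose A *v v) \<le> a * norm v"
    using linear_bounded_pos[OF matrix_vector_mul_linear[of "transpose A"]] by (metis mult.commute)
  obtain c where c: "c > 0" "\<And>v. norm (transpose B *v v) \<le> c * norm v"
    using linear_bounded_pos[OF matrix_vector_mul_linear[of "transpose B"]] by (metis mult.commute)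
  \<comment> \<open>A multiple of the identity whose form dominates that of
    \<open>B B^T\<close>.\<close>
  define Z :: "real^'n^'n" where "Z = mat (c\<^sup>2)"
  have Z_mult: "Z *v v = c\<^sup>2 *\<^sub>R v" for v
    by (simp add: Z_def vec_eq_iff matrix_vector_mult_def mat_def if_distrib[where f="\<lambda>x. x * _"] cong: if_cong)
  have Z: "psd Z" by (simp add: psd_def Z_mult) (simp add: Z_def)
  have qZ: "qnorm Z v = c * norm v" for v
    using c(1) by (simp add: qnorm_def Z_mult real_sqrt_mult norm_eq_sqrt_inner)
  define p where "p = 2 * (n + 1) * n"
  define K where "K = c\<^sup>2 * (g0 + a) ^ p"
  have K: "K > 0" using a c assms by (simp add: K_def)
  have "(norm (W g *v v))\<^sup>2 \<le> K * (1 / g) ^ (p + 1) * (wnorm g v)\<^sup>2" if g: "0 < g" "g \<le> g0" for g v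
  proof -
    have form: "u \<bullet> (W g *v u) \<le> K * (1 / g) ^ (p + 1) * (norm u)\<^sup>2" for u
    proof -
      have "u \<bullet> (W g *v u) \<le> ((1 + a / g) ^ (2 * (n + 1))) ^ n / g * (qnorm Z u)\<^sup>2"
      proof (rule lyap_form_upper_bound[OF g(1) Z _ _ _ nilpotent_transpose])
        show "v \<bullet> (lyap A g (W g) *v v) \<le> (qnorm Z v)\<^sup>2" for v
          using power_mono[OF c(2) norm_ge_zero, of v 2] by (simp add: lyap_W_form[OF g(1)] qZ)
        show "qnorm Z (transpose A *v v) \<le> a / g * g * qnorm Z v" for v
          using a(2)[of v] c(1) g(1) by (simp add: qZ mult.left_commute)
      qed (use a g in auto)
      also have "((1 + a / g) ^ (2 * (n + 1))) ^ n = (1 + a / g) ^ p"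
        by (simp only: power_mult[symmetric] p_def mult.assoc)
      also have "(1 + a / g) ^ p / g * (qnorm Z u)\<^sup>2 \<le> ((g0 + a) * (1 / g)) ^ p / g * (qnorm Z u)\<^sup>2"
        using g a by (intro mult_right_mono divide_right_mono power_mono) (auto simp: field_simps)
      also have "\<dots> = K * (1 / g) ^ (p + 1) * (norm u)\<^sup>2"
        by (simp add: K_def qZ power_mult_distrib power_divide mult_ac)
      finally show ?thesis .
    qed
    define k where "k = K * (1 / g) ^ (p + 1)"
    have k0: "k > 0" using K g by (simp add: k_def)
    have "(W g *v v) \<bullet> (W g *v v) \<le> wnorm g (W g *v v) * wnorm g v"
      using qnorm_cauchy_schwarz[OF psd_W[OF g(1)], of "W g *v v" v] by linarith
    also have "\<dots> \<le> (sqrt k * norm (W g *v v)) * wnorm g v"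
    proof (rule mult_right_mono)
      show "wnorm g (W g *v v) \<le> sqrt k * norm (W g *v v)"
        using real_sqrt_le_mono[OF form[of "W g *v v"]] unfolding k_def[symmetric]
        by (simp add: qnorm_def real_sqrt_mult)
    qed (use psd_W[OF g(1)] in simp)
    also have "\<dots> = (sqrt k * wnorm g v) * norm (W g *v v)" by simp
    finally have "(W g *v v) \<bullet> (W g *v v) \<le> (sqrt k * wnorm g v) * norm (W g *v v)" .
    then have "norm (W g *v v) \<le> sqrt k * wnorm g v"
      using k0 psd_W[OF g(1)] by (intro norm_le_of_inner) auto
    then have "(norm (W g *v v))\<^sup>2 \<le> (sqrt k * wnorm g v)\<^sup>2" by (rule power_mono) simp
    then show ?thesis using k0 by (simp add: power_mult_distrib k_def)
  qed
  then show ?thesis using K by blast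
qed

lemma P_bounds:
  assumes "g0 > 0"
  shows "\<exists>C>0. \<forall>g v. 0 < g \<longrightarrow> g \<le> g0 \<longrightarrow>
    norm v \<le> C * sqrt g * wnorm g v \<and> wnorm g (P g *v v) \<le> C * sqrt g * norm v \<and>
    norm (P g *v v) \<le> C\<^sup>2 * g * norm v"
proof -
  obtain C where C: "C > 0" "\<And>g v. 0 < g \<Longrightarrow> g \<le> g0 \<Longrightarrow> norm v \<le> C * sqrt g * wnorm g v"
    using norm_le_wnorm[OF assms] by blast
  have 2: "wnorm g (P g *v v) \<le> C * sqrt g * norm v" if g: "0 < g" "g \<le> g0" for g v
  proof -
    let ?w = "wnorm g (P g *v v)"
    have "?w * ?w = v \<bullet> (P g *v v)" using wnorm_P[OF g(1)] by (simp add: power2_eq_square)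
    also have "\<dots> \<le> norm v * norm (P g *v v)" by (rule norm_cauchy_schwarz)
    also have "\<dots> \<le> norm v * (C * sqrt g * ?w)" by (intro mult_left_mono C(2) g) simp
    finally have "?w * ?w \<le> (C * sqrt g * norm v) * ?w" by (simp add: mult_ac)
    then show ?thesis
      using qnorm_nonneg[OF psd_W[OF g(1)], of "P g *v v"] C(1) g
      by (cases "?w = 0") (auto simp: mult_le_cancel_right)
  qed
  have 3: "norm (P g *v v) \<le> C\<^sup>2 * g * norm v" if g: "0 < g" "g \<le> g0" for g v
  proof -
    have "norm (P g *v v) \<le> C * sqrt g * wnorm g (P g *v v)" by (intro C(2) g)
    also have "\<dots> \<le> C * sqrt g * (C * sqrt g * norm v)" using C(1) g 2 by (intro mult_left_mono) auto
    also have "\<dots> = C\<^sup>2 * (sqrt g * sqrt g) * norm v" by (simp only: power2_eq_square mult_ac)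
    finally show ?thesis using g by simp
  qed
  from C 2 3 show ?thesis by blast
qed

text \<open>Apply \<open>P_diff\<close> with \<open>u\<close> equal to the difference itself. Its
  purpose is continuity of \<open>P\<close> along the gain.\<close>

lemma P_lipschitz:
  assumes C: "C > 0" "\<And>g v. 0 < g \<Longrightarrow> g \<le> g0 \<Longrightarrow> wnorm g (P g *v v) \<le> C * sqrt g * norm v"
    and g: "0 < g1" "g1 \<le> g2" "g2 \<le> 2 * g1" "g2 \<le> g0"
  shows "norm (P g2 *v x - P g1 *v x) \<le> 2 * c\<^sub>W * C\<^sup>2 * (g2 - g1) * norm x"
proof (rule norm_le_of_inner)
  let ?d = "P g2 *v x - P g1 *v x"
  have "?d \<bullet> ?d \<le> c\<^sub>W * ((g2 - g1) / g1) * wnorm g1 (P g1 *v ?d) * wnorm g2 (P g2 *v x)"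
    using P_diff[OF g(1-3), of ?d x] by linarith
  also have "\<dots> \<le> c\<^sub>W * ((g2 - g1) / g1) * (C * sqrt g1 * norm ?d) * (C * sqrt g2 * norm x)"
    using C c\<^sub>W_pos g by (intro mult_mono mult_left_mono) (auto intro!: qnorm_nonneg psd_W)
  also have "\<dots> = c\<^sub>W * C\<^sup>2 * ((g2 - g1) / g1) * norm ?d * norm x * (sqrt g1 * sqrt g2)"
    by (simp add: power2_eq_square)
  \<comment> \<open>This factor cancels the denominator \<open>g1\<close> of the relative
    change.\<close>
  also have "sqrt g1 * sqrt g2 \<le> 2 * g1"
  proof -
    have "sqrt g1 * sqrt g2 = sqrt (g1 * g2)" by (simp add: real_sqrt_mult)
    also have "\<dots> \<le> sqrt ((2 * g1)\<^sup>2)"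
      using g mult_left_mono[of g2 "2 * g1" g1] by (intro real_sqrt_le_mono) (simp add: power2_eq_square)
    also have "\<dots> = 2 * g1" using g by (simp only: real_sqrt_abs)
    finally show ?thesis .
  qed
  then have "c\<^sub>W * C\<^sup>2 * ((g2 - g1) / g1) * norm ?d * norm x * (sqrt g1 * sqrt g2)
      \<le> c\<^sub>W * C\<^sup>2 * ((g2 - g1) / g1) * norm ?d * norm x * (2 * g1)"
    using c\<^sub>W_pos g by (intro mult_left_mono) auto
  also have "\<dots> = 2 * c\<^sub>W * C\<^sup>2 * (g2 - g1) * norm x * norm ?d" using g by simp
  finally show "?d \<bullet> ?d \<le> 2 * c\<^sub>W * C\<^sup>2 * (g2 - g1) * norm x * norm ?d" .
qed (use c\<^sub>W_pos g in auto)

lemma continuous_on_P: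
  assumes h: "continuous_on S h" "\<And>t. t \<in> S \<Longrightarrow> 0 < h t" "\<And>t. t \<in> S \<Longrightarrow> h t \<le> g0"
    and x: "continuous_on S x"
  shows "continuous_on S (\<lambda>t. P (h t) *v x t)"
proof (cases "S = {}")
  case False
  then have "g0 > 0" using h(2,3) by fastforce
  from P_bounds[OF this] obtain C where C: "C > 0"
    "\<And>g v. 0 < g \<Longrightarrow> g \<le> g0 \<Longrightarrow> wnorm g (P g *v v) \<le> C * sqrt g * norm v"
    "\<And>g v. 0 < g \<Longrightarrow> g \<le> g0 \<Longrightarrow> norm (P g *v v) \<le> C\<^sup>2 * g * norm v"
    by blast
  show ?thesis
    unfolding continuous_on_def
  proof
    fix t assume t: "t \<in> S"
    let ?F = "at t within S"
    have lh: "(h \<longlongrightarrow> h t) ?F" and lx: "(x \<longlongrightarrow> x t) ?F"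
      using h(1) x t by (auto simp: continuous_on_def)
    let ?bound = "\<lambda>s. C\<^sup>2 * g0 * norm (x s - x t) + 2 * c\<^sub>W * C\<^sup>2 * \<bar>h s - h t\<bar> * norm (x t)"
    have "(?bound \<longlongrightarrow> C\<^sup>2 * g0 * norm (x t - x t) + 2 * c\<^sub>W * C\<^sup>2 * \<bar>h t - h t\<bar> * norm (x t)) ?F"
      by (intro tendsto_intros lh lx)
    then have lim: "(?bound \<longlongrightarrow> 0) ?F" by simp
    have ev: "\<forall>\<^sub>F s in ?F. s \<in> S \<and> h s < 2 * h t \<and> h t / 2 < h s"
      using order_tendstoD(1)[OF lh, of "h t / 2"] order_tendstoD(2)[OF lh, of "2 * h t"] h(2)[OF t]
      by (intro eventually_conj) (simp_all add: eventually_at_filter)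
    have bound: "norm (P (h s) *v x s - P (h t) *v x t) \<le> ?bound s"
      if s: "s \<in> S \<and> h s < 2 * h t \<and> h t / 2 < h s" for s
    proof -
      have "norm (P (h s) *v x s - P (h t) *v x t)
          \<le> norm (P (h s) *v (x s - x t)) + norm (P (h s) *v x t - P (h t) *v x t)"
        by (metis (no_types, lifting) norm_triangle_ineq matrix_vector_mult_diff_distrib diff_add_cancel add_diff_eq)
      also have "norm (P (h s) *v (x s - x t)) \<le> C\<^sup>2 * g0 * norm (x s - x t)"
      proof -
        have "norm (P (h s) *v (x s - x t)) \<le> C\<^sup>2 * h s * norm (x s - x t)" using C(3) h s by simp
        also have "\<dots> \<le> C\<^sup>2 * g0 * norm (x s - x t)"
          using h s by (intro mult_right_mono mult_left_mono) auto
        finally show ?thesis .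
      qed
      also have "norm (P (h s) *v x t - P (h t) *v x t) \<le> 2 * c\<^sub>W * C\<^sup>2 * \<bar>h s - h t\<bar> * norm (x t)"
      proof (cases "h t \<le> h s")
        case True
        then show ?thesis
          using P_lipschitz[OF C(1,2), of g0 "h t" "h s" "x t"] h t s by simp
      next
        case False
        then show ?thesis
          using P_lipschitz[OF C(1,2), of g0 "h s" "h t" "x t"] h t s by (simp add: norm_minus_commute)
      qed
      finally show ?thesis by simp
    qed
    have "((\<lambda>s. P (h s) *v x s - P (h t) *v x t) \<longlongrightarrow> 0) ?F"
      by (rule Lim_null_comparison[OF _ lim]) (use ev bound in \<open>auto elim: eventually_mono\<close>)
    then show "((\<lambda>s. P (h s) *v x s) \<longlongrightarrow> P (h t) *v x t) ?F" by (simp add: LIM_zero_iff)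
  qed
qed simp

end

lemma continuous_on_atLeast:
  fixes f :: "real \<Rightarrow> 'a::topological_space"
  assumes "\<And>T. 0 \<le> T \<Longrightarrow> continuous_on {0..T} f"
  shows "continuous_on {0..} f"
  unfolding continuous_on_eq_continuous_within
proof
  fix t :: real assume "t \<in> {0..}"
  then have "continuous (at t within {0..t + 1}) f"
    using assms[of "t + 1"] by (auto simp: continuous_on_eq_continuous_within)
  moreover have "at t within {0..t + 1} = at t within {0..}"
    using \<open>t \<in> {0..}\<close> by (intro at_within_nhd[of _ "{t - 1<..<t + 1}"]) auto
  ultimately show "continuous (at t within {0..}) f" by simp
qed


section \<open>Decay of the closed loop\<close>

text \<open>The properties of the power law behind the decay: \<Gamma> is an antiderivative of
  \<gamma>, \<open>\<gamma>_slow\<close> makes \<gamma> nearly constant over a fixed delay, and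
  \<open>\<Gamma>_dominates\<close> lets the decay beat every power of
  \<open>1 / \<gamma>\<close>.\<close>

locale slow_gain =
  fixes \<gamma> \<Gamma> :: "real \<Rightarrow> real"
  assumes \<gamma>_pos: "t \<ge> 0 \<Longrightarrow> \<gamma> t > 0"
    and \<gamma>_antimono: "0 \<le> s \<Longrightarrow> s \<le> t \<Longrightarrow> \<gamma> t \<le> \<gamma> s"
    and \<gamma>_continuous: "continuous_on {0..} \<gamma>"
    and \<gamma>_lim: "(\<gamma> \<longlongrightarrow> 0) at_top"
    and \<gamma>_slow: "e > 0 \<Longrightarrow> \<forall>\<^sub>F t in at_top. \<gamma> (t - h) \<le> (1 + e) * \<gamma> t"
    and \<Gamma>_deriv: "t > 0 \<Longrightarrow> (\<Gamma> has_real_derivative \<gamma> t) (at t)"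
    and \<Gamma>_dominates: "((\<lambda>t. (1 / \<gamma> t) ^ p * exp (- \<Gamma> t / 2)) \<longlongrightarrow> 0) at_top"
begin

lemma \<gamma>_le: "t \<ge> 0 \<Longrightarrow> \<gamma> t \<le> \<gamma> 0"
  using \<gamma>_antimono by blast

lemma \<Gamma>_diff:
  assumes "0 < s" "s \<le> t"
  shows "0 \<le> \<Gamma> t - \<Gamma> s" and "\<Gamma> t - \<Gamma> s \<le> (t - s) * \<gamma> 0"
proof -
  have "0 \<le> \<Gamma> t - \<Gamma> s \<and> \<Gamma> t - \<Gamma> s \<le> (t - s) * \<gamma> 0"
  proof (cases "s = t")
    case False
    then have "s < t" using assms by simp
    from MVT2[OF this, of \<Gamma> \<gamma>] obtain z where "s < z" "\<Gamma> t - \<Gamma> s = (t - s) * \<gamma> z"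
      using assms \<Gamma>_deriv by (metis less_le_trans)
    then show ?thesis using assms \<gamma>_pos[of z] \<gamma>_le[of z] by (simp add: mult_left_mono)
  qed simp
  then show "0 \<le> \<Gamma> t - \<Gamma> s" and "\<Gamma> t - \<Gamma> s \<le> (t - s) * \<gamma> 0" by auto
qed

end

section \<open>The closed loop and its behaviour beyond the initial history\<close>

locale delay_system = nilpotent_pair A B n + slow_gain \<gamma> \<Gamma>
  for A :: "real^'n^'n" and B :: "real^'m^'n" and n :: nat and \<gamma> \<Gamma> +
  fixes q :: nat and Bs :: "nat \<Rightarrow> real^'m^'n" and tau :: "nat \<Rightarrow> real \<Rightarrow> real" and taubar :: real
  assumes B_sum: "B = (\<Sum>i=1..q. Bs i)"
    and taubar_pos: "taubar > 0"
    and tau_bounds: "i \<in> {1..q} \<Longrightarrow> t \<ge> 0 \<Longrightarrow> 0 \<le> tau i t \<and> tau i t \<le> taubar"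
    and tau_continuous: "i \<in> {1..q} \<Longrightarrow> continuous_on {0..} (tau i)"
begin

definition K :: "real \<Rightarrow> real^'n^'m" where
  "K t = - (transpose B ** ple_solution A B (\<gamma> t))"

definition y :: "(real \<Rightarrow> real^'n) \<Rightarrow> real \<Rightarrow> real^'n" where
  "y x t = P (\<gamma> t) *v x t"

lemma K_mult: "t \<ge> 0 \<Longrightarrow> K t *v v = - (transpose B *v (P (\<gamma> t) *v v))"
  by (simp add: K_def ple_solution_eq_P \<gamma>_pos matrix_vector_mul_assoc uminus_matrix_vector_mult)

lemma control_eq: "control K u0 x t = (if t < 0 then u0 t else - (transpose B *v y x t))"
  by (simp add: control_def K_mult y_def)

lemma W_y: "t \<ge> 0 \<Longrightarrow> W (\<gamma> t) *v y x t = x t"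
  by (simp add: y_def W_P_apply \<gamma>_pos)

lemma Bs_bound: "\<exists>\<beta>>0. \<forall>i\<in>{1..q}. \<forall>u v. norm (Bs i *v u) \<le> \<beta> * norm u \<and> norm (transpose (Bs i) *v v) \<le> \<beta> * norm v"
proof -
  define \<beta> where "\<beta> = 1 + (\<Sum>i=1..q. onorm ((*v) (Bs i)) + onorm ((*v) (transpose (Bs i))))"
  have nn: "0 \<le> onorm ((*v) (Bs i)) + onorm ((*v) (transpose (Bs i)))" for i
    by (intro add_nonneg_nonneg onorm_pos_le matrix_vector_mul_bounded_linear)
  have "norm (Bs i *v u) \<le> \<beta> * norm u \<and> norm (transpose (Bs i) *v v) \<le> \<beta> * norm v"
    if "i \<in> {1..q}" for i u v
  proof -
    have le: "onorm ((*v) (Bs i)) + onorm ((*v) (transpose (Bs i))) \<le> \<beta>"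
      unfolding \<beta>_def using member_le_sum[OF that, of "\<lambda>i. onorm ((*v) (Bs i)) + onorm ((*v) (transpose (Bs i)))"] nn
      by simp
    have nn1: "0 \<le> onorm ((*v) (Bs i))" "0 \<le> onorm ((*v) (transpose (Bs i)))"
      by (intro onorm_pos_le matrix_vector_mul_bounded_linear)+
    have "norm (Bs i *v u) \<le> onorm ((*v) (Bs i)) * norm u" "norm (transpose (Bs i) *v v) \<le> onorm ((*v) (transpose (Bs i))) * norm v"
      by (intro onorm matrix_vector_mul_bounded_linear)+
    moreover have "onorm ((*v) (Bs i)) * norm u \<le> \<beta> * norm u" "onorm ((*v) (transpose (Bs i))) * norm v \<le> \<beta> * norm v"
      using le nn1 by (intro mult_right_mono; simp)+
    ultimately show ?thesis by linarith
  qed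
  moreover have "\<beta> > 0" unfolding \<beta>_def using nn by (simp add: add_pos_nonneg sum_nonneg)
  ultimately show ?thesis by blast
qed

abbreviation rhs :: "(real \<Rightarrow> real^'m) \<Rightarrow> (real \<Rightarrow> real^'n) \<Rightarrow> real \<Rightarrow> real^'n" where
  "rhs u0 x \<equiv> \<lambda>s. A *v x s + (\<Sum>i=1..q. Bs i *v control K u0 x (s - tau i s))"

text \<open>The right-hand side once all delayed times are nonnegative. Unlike \<open>rhs\<close>,
  it does not involve the merely measurable history and is continuous from \<open>taubar\<close>
  on.\<close>

definition F :: "(real \<Rightarrow> real^'n) \<Rightarrow> real \<Rightarrow> real^'n" where
  "F x t = A *v x t - (\<Sum>i=1..q. Bs i *v (transpose B *v y x (t - tau i t)))"

abbreviation N :: "(real \<Rightarrow> real^'n) \<Rightarrow> real \<Rightarrow> real" where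
  "N x t \<equiv> wnorm (\<gamma> t) (y x t)"

lemma N_nonneg: "t \<ge> 0 \<Longrightarrow> 0 \<le> N x t"
  by (simp add: psd_W \<gamma>_pos)

lemma N_power2: "t \<ge> 0 \<Longrightarrow> (N x t)\<^sup>2 = x t \<bullet> y x t"
  by (simp add: y_def wnorm_P \<gamma>_pos)

lemma y_continuous: "continuous_on {0..} x \<Longrightarrow> continuous_on {0..} (y x)"
  unfolding y_def[abs_def]
  by (rule continuous_on_P[where ?g0.0 = "\<gamma> 0"]) (use \<gamma>_continuous \<gamma>_pos \<gamma>_le in auto)

lemma delayed_nonneg: "i \<in> {1..q} \<Longrightarrow> taubar \<le> t \<Longrightarrow> 0 \<le> t - tau i t"
  using tau_bounds[of i t] taubar_pos by fastforce

lemma F_continuous: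
  assumes "continuous_on {0..} x"
  shows "continuous_on {taubar..} (F x)"
proof -
  have sub: "{taubar..} \<subseteq> {0..}" using taubar_pos by auto
  have "continuous_on {taubar..} (\<lambda>t. y x (t - tau i t))" if "i \<in> {1..q}" for i
    by (rule continuous_on_compose2[OF y_continuous[OF assms]])
      (use that delayed_nonneg in \<open>auto intro!: continuous_intros continuous_on_subset[OF tau_continuous sub]\<close>)
  then show ?thesis
    unfolding F_def[abs_def]
    by (intro continuous_intros continuous_on_subset[OF assms sub] linear_continuous_on_compose[OF _ matrix_vector_mul_linear]) auto
qed

lemma rhs_eq_F:
  assumes "taubar \<le> t"
  shows "rhs u0 x t = F x t"
proof -
  have "Bs i *v control K u0 x (t - tau i t) = - (Bs i *v (transpose B *v y x (t - tau i t)))"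
    if "i \<in> {1..q}" for i
    using delayed_nonneg[OF that assms] by (simp add: control_eq vec.neg)
  then show ?thesis by (simp add: F_def sum_negf)
qed

definition sol :: "real^'n \<Rightarrow> (real \<Rightarrow> real^'m) \<Rightarrow> (real \<Rightarrow> real^'n) \<Rightarrow> bool" where
  "sol x0 u0 x \<longleftrightarrow> closed_loop_solution A q Bs tau K x0 u0 x"

lemma sol_integrable:
  assumes "sol x0 u0 x" "T \<ge> 0"
  shows "rhs u0 x integrable_on {0..T}"
  using assms by (auto simp: sol_def closed_loop_solution_def integral_curve_def
      dest: set_lebesgue_integral_eq_integral(1))

lemma sol_integral:
  assumes "sol x0 u0 x" "t \<ge> 0"
  shows "x t = x0 + integral {0..t} (rhs u0 x)"
proof -
  have "integral_curve (rhs u0 x) x t" "x 0 = x0"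
    using assms by (simp_all add: sol_def closed_loop_solution_def)
  then show ?thesis using assms(2) unfolding integral_curve_def by simp
qed

lemma sol_continuous:
  assumes "sol x0 u0 x"
  shows "continuous_on {0..} x"
proof (rule continuous_on_atLeast)
  fix T :: real assume "0 \<le> T"
  have "continuous_on {0..T} (\<lambda>t. x0 + integral {0..t} (rhs u0 x))"
    by (intro continuous_intros indefinite_integral_continuous_1 sol_integrable[OF assms \<open>0 \<le> T\<close>])
  then show "continuous_on {0..T} x"
    by (rule continuous_on_eq) (use sol_integral[OF assms] in auto)
qed

text \<open>The integral equation gives a derivative only almost everywhere; after
  \<open>taubar\<close> the integrand is the continuous \<open>F\<close>, so the derivative exists
  at every point, as the mean value theorem below requires.\<close>

lemma sol_deriv:
  assumes "sol x0 u0 x" "t > taubar"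
  shows "(x has_vector_derivative F x t) (at t)"
proof -
  define T where "T = t + 1"
  note cx = sol_continuous[OF assms(1)]
  have int: "rhs u0 x integrable_on {0..s}" if "s \<ge> 0" for s using sol_integrable[OF assms(1) that] .
  have F: "F x integrable_on {taubar..T}"
    by (intro integrable_continuous_real continuous_on_subset[OF F_continuous[OF cx]]) auto
  have "((\<lambda>s. integral {taubar..s} (F x)) has_vector_derivative F x t) (at t within {taubar..T})"
    by (rule integral_has_vector_derivative)
      (use assms(2) in \<open>auto simp: T_def intro: continuous_on_subset[OF F_continuous[OF cx]]\<close>)
  then have "((\<lambda>s. x taubar + integral {taubar..s} (F x)) has_vector_derivative F x t) (at t within {taubar..T})"
    by (auto intro: derivative_eq_intros)
  then have "(x has_vector_derivative F x t) (at t within {taubar..T})"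
  proof (rule has_vector_derivative_transform[rotated 2])
    fix s assume s: "s \<in> {taubar..T}"
    have "integral {0..s} (rhs u0 x) = integral {0..taubar} (rhs u0 x) + integral {taubar..s} (rhs u0 x)"
      using s taubar_pos by (intro Henstock_Kurzweil_Integration.integral_combine[symmetric] int) auto
    also have "integral {taubar..s} (rhs u0 x) = integral {taubar..s} (F x)"
      by (intro integral_cong rhs_eq_F) auto
    finally show "x s = x taubar + integral {taubar..s} (F x)"
      using s taubar_pos sol_integral[OF assms(1), of s] sol_integral[OF assms(1), of taubar] by simp
  qed (use assms(2) in \<open>auto simp: T_def\<close>)
  then show ?thesis
    using assms(2) by (simp add: at_within_Icc_at T_def)
qed

text \<open>The time from which the estimate holds is chosen before the solution; this uniformity is
  what makes the final decay rate common to all initial data. \<open>m\<close> bounds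
  \<open>N\<close> over two delays: one for the difference \<open>y t - y (t - tau)\<close>, a
  second for the delayed controls driving \<open>x\<close> meanwhile.\<close>

lemma key_estimate:
  assumes "\<epsilon> > 0"
  shows "\<forall>\<^sub>F t in at_top. \<forall>x0 u0 x m. sol x0 u0 x \<longrightarrow> (\<forall>r\<in>{t - 2 * taubar..t}. N x r \<le> m) \<longrightarrow>
    2 * (y x t \<bullet> F x t) \<le> - \<gamma> t * (N x t)\<^sup>2 + \<epsilon> * \<gamma> t * m\<^sup>2"
proof -
  have g0: "\<gamma> 0 > 0" by (simp add: \<gamma>_pos)
  obtain C where C: "C > 0" "\<And>g v. 0 < g \<Longrightarrow> g \<le> \<gamma> 0 \<Longrightarrow> norm v \<le> C * sqrt g * wnorm g v"
    using norm_le_wnorm[OF g0] by blast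
  obtain \<beta> where \<beta>: "\<beta> > 0" "\<And>i u. i \<in> {1..q} \<Longrightarrow> norm (Bs i *v u) \<le> \<beta> * norm u"
    "\<And>i v. i \<in> {1..q} \<Longrightarrow> norm (transpose (Bs i) *v v) \<le> \<beta> * norm v"
    using Bs_bound by blast
  \<comment> \<open>\<open>R * \<gamma> t\<close> bounds the velocity \<open>F\<close> in the dual
    of the norm of \<open>W (\<gamma> t)\<close>: the first term comes from \<open>A\<close>, the
    second from the \<open>q\<close> delayed controls.\<close>
  define R where "R = 2 * real n + 2 * real q * \<beta> * C * b"
  have R: "R \<ge> 0" unfolding R_def using \<beta>(1) C(1) b_pos by simp
  define Z where "Z = 2 * real q * \<beta> * C * b"
  have Z: "Z \<ge> 0" unfolding Z_def using \<beta>(1) C(1) b_pos by simp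
  have half: "(p + 1) * (\<epsilon> / (2 * (p + 1))) = \<epsilon> / 2" if "0 \<le> p" for p :: real
    using that by (simp add: field_simps)
  \<comment> \<open>The error is \<open>(Z * taubar * R * \<gamma> t + Z * c\<^sub>W * e) * \<gamma>
    t * m\<^sup>2\<close>. Here \<open>e\<close> bounds the relative change of \<gamma> over the
    window and \<open>h\<close> below bounds \<gamma> itself; each makes one summand at most
    \<open>\<epsilon> / 2\<close>. The cap 1 provides the factor-two comparability required by
    \<open>P_diff\<close>.\<close>
  define e where "e = min 1 (\<epsilon> / (2 * (Z * c\<^sub>W + 1)))"
  have e: "e > 0" "e \<le> 1" unfolding e_def using assms Z c\<^sub>W_pos by (auto simp: add_nonneg_pos)
  have eZ: "Z * c\<^sub>W * e \<le> \<epsilon> / 2"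
  proof -
    have "Z * c\<^sub>W * e \<le> (Z * c\<^sub>W + 1) * (\<epsilon> / (2 * (Z * c\<^sub>W + 1)))"
      using Z c\<^sub>W_pos e(1) unfolding e_def by (intro mult_mono) auto
    also have "\<dots> = \<epsilon> / 2" using Z c\<^sub>W_pos by (intro half) simp
    finally show ?thesis .
  qed
  define h where "h = \<epsilon> / (2 * (Z * taubar * R + 1))"
  have h: "h > 0" unfolding h_def using assms Z R taubar_pos by (auto intro!: divide_pos_pos add_nonneg_pos mult_nonneg_nonneg)
  have hZ: "Z * taubar * R * h \<le> \<epsilon> / 2"
  proof -
    have p: "0 \<le> Z * taubar * R" using Z R taubar_pos by simp
    then have "Z * taubar * R * h \<le> (Z * taubar * R + 1) * h" using h by (intro mult_right_mono) auto
    also have "\<dots> = \<epsilon> / 2" unfolding h_def using p by (rule half)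
    finally show ?thesis .
  qed
  have "\<forall>\<^sub>F t in at_top. \<gamma> t < h \<and> \<gamma> (t - 2 * taubar) \<le> (1 + e) * \<gamma> t \<and> 2 * taubar < t"
    using order_tendstoD(2)[OF \<gamma>_lim h] \<gamma>_slow[OF e(1)] eventually_gt_at_top
    by (intro eventually_conj) auto
  then show ?thesis
  proof (rule eventually_mono, intro allI impI)
    fix t x0 u0 x m
    assume t: "\<gamma> t < h \<and> \<gamma> (t - 2 * taubar) \<le> (1 + e) * \<gamma> t \<and> 2 * taubar < t"
      and sol: "sol x0 u0 x" and "\<forall>r\<in>{t - 2 * taubar..t}. N x r \<le> m"
    then have m: "N x r \<le> m" if "t - 2 * taubar \<le> r" "r \<le> t" for r using that by auto
    have t0: "t > 0" and gt: "\<gamma> t > 0" using t taubar_pos \<gamma>_pos by auto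
    have m0: "0 \<le> m" using N_nonneg[of t x] m[of t] t0 taubar_pos by linarith
    have win: "\<gamma> t \<le> \<gamma> r" "\<gamma> r \<le> (1 + e) * \<gamma> t" "\<gamma> r \<le> 2 * \<gamma> t" "0 < \<gamma> r" "\<gamma> r \<le> \<gamma> 0"
      if r: "t - 2 * taubar \<le> r" "r \<le> t" for r
    proof -
      show "\<gamma> t \<le> \<gamma> r" "0 < \<gamma> r" "\<gamma> r \<le> \<gamma> 0" using r t \<gamma>_antimono \<gamma>_pos \<gamma>_le by auto
      show 1: "\<gamma> r \<le> (1 + e) * \<gamma> t" using \<gamma>_antimono[of "t - 2 * taubar" r] r t by linarith
      have "(1 + e) * \<gamma> t \<le> 2 * \<gamma> t" using e gt by simp
      with 1 show "\<gamma> r \<le> 2 * \<gamma> t" by linarith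
    qed
    have diff: "\<bar>z \<bullet> (transpose B *v (y x t - y x s))\<bar>
        \<le> b * sqrt (\<gamma> t) * norm z * m * (taubar * R * \<gamma> t + c\<^sub>W * e)"
      if s: "t - taubar \<le> s" "s \<le> t" for s z
    proof -
      have s2: "t - 2 * taubar \<le> s" using s taubar_pos by simp
      \<comment> \<open>Moving the gain at time \<open>t\<close> onto the test vector separates the
        two causes of change: \<open>x\<close> moves while the gain is frozen, and then the gain
        moves while \<open>x s\<close> is fixed.\<close>
      define p where "p = P (\<gamma> t) *v (B *v z)"
      have p: "wnorm (\<gamma> t) p \<le> b * sqrt (\<gamma> t) * norm z" unfolding p_def by (rule wnorm_P_B[OF gt])
      have pw: "0 \<le> wnorm (\<gamma> t) p" by (simp add: psd_W gt)
      have pF: "\<bar>p \<bullet> F x r\<bar> \<le> R * \<gamma> t * wnorm (\<gamma> t) p * m"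
        if r: "t - taubar \<le> r" "r \<le> t" for r
      proof -
        have r2: "t - 2 * taubar \<le> r" and rt: "taubar \<le> r" using r t taubar_pos by simp_all
        note wr = win[OF r2 r(2)]
        have "\<bar>p \<bullet> (A *v x r)\<bar> = \<bar>(transpose A *v p) \<bullet> (W (\<gamma> r) *v y x r)\<bar>"
          using W_y[of r] r t by (simp add: inner_matrix_transpose)
        also have "\<dots> \<le> wnorm (\<gamma> r) (transpose A *v p) * N x r"
          by (rule qnorm_cauchy_schwarz[OF psd_W[OF wr(4)]])
        also have "\<dots> \<le> (real n * \<gamma> r * wnorm (\<gamma> r) p) * m"
          using wnorm_transpose_A[OF wr(4)] m[OF r2 r(2)] N_nonneg[of r] wr(4) r t
          by (intro mult_mono) (auto intro!: mult_nonneg_nonneg qnorm_nonneg psd_W)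
        also have "\<dots> \<le> (real n * (2 * \<gamma> t) * wnorm (\<gamma> t) p) * m"
          using wr m0 gt wnorm_antimono[OF gt wr(1), of p]
          by (intro mult_right_mono mult_mono mult_left_mono) (auto intro!: mult_nonneg_nonneg qnorm_nonneg psd_W)
        finally have 1: "\<bar>p \<bullet> (A *v x r)\<bar> \<le> 2 * real n * \<gamma> t * wnorm (\<gamma> t) p * m" by (simp add: mult_ac)
        have 2: "\<bar>p \<bullet> (Bs i *v (transpose B *v y x (r - tau i r)))\<bar>
            \<le> 2 * \<beta> * C * b * \<gamma> t * wnorm (\<gamma> t) p * m" if i: "i \<in> {1..q}" for i
        proof -
          let ?f = "r - tau i r"
          have f: "t - 2 * taubar \<le> ?f" "?f \<le> t" using tau_bounds[OF i, of r] r t taubar_pos by auto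
          note wf = win[OF f]
          have "\<bar>p \<bullet> (Bs i *v (transpose B *v y x ?f))\<bar> = \<bar>(transpose (Bs i) *v p) \<bullet> (transpose B *v y x ?f)\<bar>"
            by (simp add: inner_matrix_transpose)
          also have "\<dots> \<le> norm (transpose (Bs i) *v p) * norm (transpose B *v y x ?f)"
            by (rule Cauchy_Schwarz_ineq2)
          also have "\<dots> \<le> (\<beta> * (C * sqrt (\<gamma> t) * wnorm (\<gamma> t) p)) * (b * (2 * sqrt (\<gamma> t)) * m)"
          proof (rule mult_mono)
            show "norm (transpose (Bs i) *v p) \<le> \<beta> * (C * sqrt (\<gamma> t) * wnorm (\<gamma> t) p)"
            proof -
              have "norm (transpose (Bs i) *v p) \<le> \<beta> * norm p" by (rule \<beta>(3)[OF i])
              also have "\<dots> \<le> \<beta> * (C * sqrt (\<gamma> t) * wnorm (\<gamma> t) p)"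
                using \<beta>(1) t0 by (intro mult_left_mono C(2) gt \<gamma>_le) auto
              finally show ?thesis .
            qed
            \<comment> \<open>Relaxing 2 to 4 keeps the square root of the constant
              rational.\<close>
            have "sqrt (\<gamma> ?f) \<le> sqrt (4 * \<gamma> t)" using wf gt by (intro real_sqrt_le_mono) linarith
            then have sq: "sqrt (\<gamma> ?f) \<le> 2 * sqrt (\<gamma> t)" by (simp add: real_sqrt_mult)
            have "norm (transpose B *v y x ?f) \<le> b * sqrt (\<gamma> ?f) * N x ?f"
              by (rule norm_transpose_B[OF wf(4)])
            also have "\<dots> \<le> b * (2 * sqrt (\<gamma> t)) * m"
              using sq m[OF f] b_pos gt wf(4) by (intro mult_mono mult_left_mono) (auto intro!: qnorm_nonneg psd_W)
            finally show "norm (transpose B *v y x ?f) \<le> b * (2 * sqrt (\<gamma> t)) * m" .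
          qed (use \<beta>(1) C(1) gt pw in auto)
          also have "\<dots> = 2 * \<beta> * C * b * (sqrt (\<gamma> t) * sqrt (\<gamma> t)) * wnorm (\<gamma> t) p * m"
            by (simp only: mult_ac)
          finally show ?thesis using gt by simp
        qed
        have "p \<bullet> F x r = p \<bullet> (A *v x r) - (\<Sum>i=1..q. p \<bullet> (Bs i *v (transpose B *v y x (r - tau i r))))"
          by (simp add: F_def inner_diff_right inner_sum_right)
        then have "\<bar>p \<bullet> F x r\<bar> \<le> \<bar>p \<bullet> (A *v x r)\<bar>
            + (\<Sum>i=1..q. \<bar>p \<bullet> (Bs i *v (transpose B *v y x (r - tau i r)))\<bar>)"
          using sum_abs[of "\<lambda>i. p \<bullet> (Bs i *v (transpose B *v y x (r - tau i r)))" "{1..q}"] by linarith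
        also have "(\<Sum>i=1..q. \<bar>p \<bullet> (Bs i *v (transpose B *v y x (r - tau i r)))\<bar>)
            \<le> real q * (2 * \<beta> * C * b * \<gamma> t * wnorm (\<gamma> t) p * m)"
          using sum_bounded_above[of "{1..q}", OF 2] by simp
        finally show ?thesis using 1 by (simp add: R_def algebra_simps)
      qed
      have "\<bar>p \<bullet> x t - p \<bullet> x s\<bar> \<le> taubar * (R * \<gamma> t * wnorm (\<gamma> t) p * m)"
      proof (cases "s = t")
        case True
        then show ?thesis using taubar_pos R gt pw m0 by simp
      next
        case False
        then have "s < t" using s by simp
        have "((\<lambda>r. p \<bullet> x r) has_real_derivative p \<bullet> F x r) (at r)" if "s \<le> r" for r
          using bounded_linear.has_vector_derivative[OF bounded_linear_inner_right sol_deriv[OF sol]] that s t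
          by (simp add: has_real_derivative_iff_has_vector_derivative)
        then obtain \<xi> where \<xi>: "s < \<xi>" "\<xi> < t" "p \<bullet> x t - p \<bullet> x s = (t - s) * (p \<bullet> F x \<xi>)"
          using MVT2[OF \<open>s < t\<close>, of "\<lambda>r. p \<bullet> x r" "\<lambda>r. p \<bullet> F x r"] by blast
        have "\<bar>(t - s) * (p \<bullet> F x \<xi>)\<bar> \<le> taubar * (R * \<gamma> t * wnorm (\<gamma> t) p * m)"
          unfolding abs_mult using \<xi> s pF[of \<xi>] by (intro mult_mono) auto
        then show ?thesis using \<xi> by simp
      qed
      moreover have "\<bar>(B *v z) \<bullet> (P (\<gamma> s) *v x s - P (\<gamma> t) *v x s)\<bar> \<le> c\<^sub>W * e * wnorm (\<gamma> t) p * m"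
      proof -
        note ws = win[OF s2 s(2)]
        have q: "(\<gamma> s - \<gamma> t) / \<gamma> t \<le> e" using ws(2) gt by (simp add: field_simps)
        have "\<bar>(B *v z) \<bullet> (P (\<gamma> s) *v x s - P (\<gamma> t) *v x s)\<bar>
            \<le> c\<^sub>W * ((\<gamma> s - \<gamma> t) / \<gamma> t) * wnorm (\<gamma> t) p * N x s"
          unfolding p_def y_def by (rule P_diff[OF gt ws(1,3)])
        also have "\<dots> \<le> c\<^sub>W * e * wnorm (\<gamma> t) p * m"
          using q c\<^sub>W_pos pw m[OF s2 s(2)] e ws gt
          by (intro mult_mono mult_left_mono) (auto intro!: qnorm_nonneg psd_W)
        finally show ?thesis .
      qed
      moreover have "z \<bullet> (transpose B *v (y x t - y x s))
          = (p \<bullet> x t - p \<bullet> x s) - (B *v z) \<bullet> (P (\<gamma> s) *v x s - P (\<gamma> t) *v x s)"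
      proof -
        have "z \<bullet> (transpose B *v v) = (B *v z) \<bullet> v" for v
          by (metis inner_matrix_transpose inner_commute)
        moreover have "p \<bullet> v = (B *v z) \<bullet> (P (\<gamma> t) *v v)" for v
          by (simp only: p_def P_sym[OF gt])
        ultimately show ?thesis by (simp only: y_def inner_diff_right)
      qed
      ultimately have "\<bar>z \<bullet> (transpose B *v (y x t - y x s))\<bar>
          \<le> taubar * (R * \<gamma> t * wnorm (\<gamma> t) p * m) + c\<^sub>W * e * wnorm (\<gamma> t) p * m" by linarith
      also have "\<dots> = wnorm (\<gamma> t) p * (m * (taubar * R * \<gamma> t + c\<^sub>W * e))" by (simp add: algebra_simps)
      also have "\<dots> \<le> (b * sqrt (\<gamma> t) * norm z) * (m * (taubar * R * \<gamma> t + c\<^sub>W * e))"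
        using p m0 taubar_pos R gt c\<^sub>W_pos e by (intro mult_right_mono) auto
      finally show ?thesis by (simp add: mult_ac)
    qed
    let ?y = "y x t"
    \<comment> \<open>The part of \<open>y \<bullet> F\<close> caused by the \<open>i\<close>-th
      delay. The vector \<open>transpose (Bs i) *v ?y\<close> supplies a second factor
      \<open>sqrt (\<gamma> t)\<close>, so the error has the full order
      \<open>\<gamma> t\<close>.\<close>
    let ?d = "\<lambda>i. (transpose (Bs i) *v ?y) \<bullet> (transpose B *v (?y - y x (t - tau i t)))"
    have d: "?d i \<le> \<beta> * C * b * \<gamma> t * m\<^sup>2 * (taubar * R * \<gamma> t + c\<^sub>W * e)" if i: "i \<in> {1..q}" for i
    proof -
      let ?z = "transpose (Bs i) *v ?y"
      have "?d i \<le> b * sqrt (\<gamma> t) * norm ?z * m * (taubar * R * \<gamma> t + c\<^sub>W * e)"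
        using diff[of "t - tau i t" ?z] tau_bounds[OF i, of t] t0 by fastforce
      also have "\<dots> \<le> b * sqrt (\<gamma> t) * (\<beta> * (C * sqrt (\<gamma> t) * m)) * m * (taubar * R * \<gamma> t + c\<^sub>W * e)"
      proof (intro mult_right_mono mult_left_mono)
        have "norm ?z \<le> \<beta> * norm ?y" by (rule \<beta>(3)[OF i])
        also have "\<dots> \<le> \<beta> * (C * sqrt (\<gamma> t) * N x t)"
          using \<beta>(1) t0 by (intro mult_left_mono C(2) gt \<gamma>_le) auto
        also have "\<dots> \<le> \<beta> * (C * sqrt (\<gamma> t) * m)"
          using \<beta>(1) C(1) gt m[of t] taubar_pos by (intro mult_left_mono) auto
        finally show "norm ?z \<le> \<beta> * (C * sqrt (\<gamma> t) * m)" .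
      qed (use b_pos gt m0 taubar_pos R c\<^sub>W_pos e in auto)
      also have "\<dots> = \<beta> * C * b * (sqrt (\<gamma> t) * sqrt (\<gamma> t)) * m\<^sup>2 * (taubar * R * \<gamma> t + c\<^sub>W * e)"
        by (simp only: mult_ac power2_eq_square)
      finally show ?thesis using gt by simp
    qed
    have "2 * (\<Sum>i=1..q. ?d i) \<le> 2 * (real q * (\<beta> * C * b * \<gamma> t * m\<^sup>2 * (taubar * R * \<gamma> t + c\<^sub>W * e)))"
      using sum_bounded_above[of "{1..q}" ?d, OF d] by simp
    also have "\<dots> = (Z * taubar * R * \<gamma> t + Z * c\<^sub>W * e) * (\<gamma> t * m\<^sup>2)" by (simp add: Z_def algebra_simps)
    also have "\<dots> \<le> \<epsilon> * (\<gamma> t * m\<^sup>2)"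
    proof (rule mult_right_mono)
      have "Z * taubar * R * \<gamma> t \<le> Z * taubar * R * h"
        using t Z R taubar_pos by (intro mult_left_mono) auto
      then show "Z * taubar * R * \<gamma> t + Z * c\<^sub>W * e \<le> \<epsilon>" using hZ eZ by linarith
    qed (use gt in simp)
    finally have S: "2 * (\<Sum>i=1..q. ?d i) \<le> \<epsilon> * \<gamma> t * m\<^sup>2" by simp
    have "y x t \<bullet> F x t = ?y \<bullet> (A *v x t) - (\<Sum>i=1..q. (transpose (Bs i) *v ?y) \<bullet> (transpose B *v y x (t - tau i t)))"
      by (simp add: F_def inner_diff_right inner_sum_right inner_matrix_transpose)
    also have "(\<Sum>i=1..q. (transpose (Bs i) *v ?y) \<bullet> (transpose B *v y x (t - tau i t)))
        = (\<Sum>i=1..q. (transpose (Bs i) *v ?y) \<bullet> (transpose B *v ?y)) - (\<Sum>i=1..q. ?d i)"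
      by (simp add: matrix_vector_mult_diff_distrib inner_diff_right sum_subtractf)
    also have "(\<Sum>i=1..q. (transpose (Bs i) *v ?y) \<bullet> (transpose B *v ?y)) = (norm (transpose B *v ?y))\<^sup>2"
    proof -
      have "(\<Sum>i=1..q. (transpose (Bs i) *v ?y) \<bullet> (transpose B *v ?y)) = ?y \<bullet> (B *v (transpose B *v ?y))"
        unfolding B_sum by (simp add: inner_matrix_transpose sum_matrix_vector_mult inner_sum_right)
      then show ?thesis by (simp add: power2_norm_eq_inner inner_matrix_transpose)
    qed
    finally have yF: "y x t \<bullet> F x t
        = ?y \<bullet> (A *v x t) - (norm (transpose B *v ?y))\<^sup>2 + (\<Sum>i=1..q. ?d i)" by simp
    \<comment> \<open>This is the Lyapunov equation for \<open>W (\<gamma> t)\<close> tested with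
      \<open>?y\<close>. Feedback without delay subtracts twice the square of \<open>B^T y\<close>,
      so a nonpositive square is left over and dropped.\<close>
    have "2 * (?y \<bullet> (A *v x t)) = (norm (transpose B *v ?y))\<^sup>2 - \<gamma> t * (N x t)\<^sup>2"
    proof -
      have "?y \<bullet> (A *v x t) = (transpose A *v ?y) \<bullet> (W (\<gamma> t) *v ?y)"
        using W_y[of t x] t0 by (simp add: inner_matrix_transpose)
      then show ?thesis
        using lyap_W_form[OF gt, of ?y] psd_sym[OF psd_W[OF gt], of ?y "transpose A *v ?y"]
          qnorm_power2[OF psd_W[OF gt], of ?y]
        by (simp add: lyap_form)
    qed
    then show "2 * (y x t \<bullet> F x t) \<le> - \<gamma> t * (N x t)\<^sup>2 + \<epsilon> * \<gamma> t * m\<^sup>2"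
      using yF S by (simp add: algebra_simps) (smt (verit) zero_le_power2)
  qed
qed

text \<open>
  As \<open>W (\<gamma> s) \<le> W (\<gamma> t)\<close> for \<open>s \<le> t\<close>, a function of \<open>s\<close> that is differentiable together with \<open>x\<close> lies below
  \<open>(N x)\<^sup>2\<close> to the left of \<open>t\<close> and touches it at \<open>t\<close>. So \<open>P\<close> never has to be differentiated.
\<close>

lemma touching_minorant:
  assumes "0 \<le> s" "s \<le> t"
  shows "2 * (y x t \<bullet> x s) - (N x t)\<^sup>2 \<le> (N x s)\<^sup>2"
proof -
  have gs: "\<gamma> s > 0" and gt: "\<gamma> t > 0" and le: "\<gamma> t \<le> \<gamma> s" using assms \<gamma>_pos \<gamma>_antimono by auto
  note sym = psd_sym[OF psd_W[OF gs]]
  have "0 \<le> (y x s - y x t) \<bullet> (W (\<gamma> s) *v (y x s - y x t))"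
    using psd_W[OF gs] by (simp add: psd_def)
  also have "\<dots> = (N x s)\<^sup>2 - 2 * (y x t \<bullet> (W (\<gamma> s) *v y x s)) + y x t \<bullet> (W (\<gamma> s) *v y x t)"
    using sym[of "y x s" "y x t"]
    by (simp add: qnorm_power2[OF psd_W[OF gs]] matrix_vector_mult_diff_distrib inner_diff_left inner_diff_right)
  also have "W (\<gamma> s) *v y x s = x s" using W_y assms by simp
  also have "y x t \<bullet> (W (\<gamma> s) *v y x t) \<le> (N x t)\<^sup>2"
    using psd_W_diff[OF gt le]
    by (simp add: psd_def qnorm_power2[OF psd_W[OF gt]] matrix_vector_mult_diff_rdistrib inner_diff_right)
  finally show ?thesis by simp
qed

text \<open>At the first time the comparison function is met, the past values of \<open>V\<close>
  are at most \<open>E\<close> times the present one. The delay error is then a fraction of the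
  decay term, and \<open>V\<close> would have to fall faster than the function it has just reached
  from below.\<close>

lemma halanay:
  "\<exists>T\<ge>3 * taubar. \<forall>x0 u0 x M. sol x0 u0 x \<longrightarrow> 0 < M \<longrightarrow> (\<forall>r\<in>{T - 2 * taubar..T}. (N x r)\<^sup>2 < M) \<longrightarrow>
    (\<forall>t\<ge>T. (N x t)\<^sup>2 \<le> M * exp (- (\<Gamma> t - \<Gamma> T) / 2))"
proof -
  \<comment> \<open>Over two delays \<Gamma> grows by at most
    \<open>2 * taubar * \<gamma> 0\<close>, and the exponent of the comparison function carries the
    factor 1/2.\<close>
  define E where "E = exp (taubar * \<gamma> 0)"
  have E: "E > 0" by (simp add: E_def)
  \<comment> \<open>With \<open>m\<^sup>2 = E * V t'\<close> this leaves decay at rate 3/4 of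
    \<gamma>, strictly more than the rate 1/2 of the comparison function.\<close>
  have "1 / (4 * E) > 0" using E by simp
  from key_estimate[OF this] obtain T0 where T0: "\<And>t x0 u0 x m. T0 \<le> t \<Longrightarrow> sol x0 u0 x \<Longrightarrow>
      (\<forall>r\<in>{t - 2 * taubar..t}. N x r \<le> m) \<Longrightarrow>
      2 * (y x t \<bullet> F x t) \<le> - \<gamma> t * (N x t)\<^sup>2 + 1 / (4 * E) * \<gamma> t * m\<^sup>2"
    unfolding eventually_at_top_linorder by blast
  \<comment> \<open>The window before \<open>T\<close> then starts no earlier than
    \<open>taubar\<close>, hence at positive times, where \<Gamma> is differentiable.\<close>
  define T where "T = max T0 (3 * taubar)"
  have T: "T0 \<le> T" "3 * taubar \<le> T" by (auto simp: T_def)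
  have "(N x t)\<^sup>2 \<le> M * exp (- (\<Gamma> t - \<Gamma> T) / 2)"
    if sol: "sol x0 u0 x" and M: "0 < M" and start: "\<forall>r\<in>{T - 2 * taubar..T}. (N x r)\<^sup>2 < M" and "T \<le> t"
    for x0 u0 x M t
  proof (rule ccontr)
    define \<beta> where "\<beta> = (\<lambda>t. M * exp (- (\<Gamma> t - \<Gamma> T) / 2))"
    define V where "V = (\<lambda>t. (N x t)\<^sup>2)"
    have \<beta>_pos: "\<beta> s > 0" for s using M by (simp add: \<beta>_def)
    have cont_x: "continuous_on {0..} x" by (rule sol_continuous[OF sol])
    have sub: "{T..} \<subseteq> {0..}" using T taubar_pos by auto
    have "continuous_on {T..} (\<lambda>t. x t \<bullet> y x t)"
      by (intro continuous_intros continuous_on_subset[OF cont_x sub] continuous_on_subset[OF y_continuous[OF cont_x] sub])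
    then have contV: "continuous_on {T..} V"
      by (rule continuous_on_eq) (use sub in \<open>auto simp: V_def N_power2\<close>)
    have "continuous_on {T..} \<Gamma>"
      using \<Gamma>_deriv T taubar_pos
      by (intro DERIV_continuous_on[where D = \<gamma>]) (auto intro: has_field_derivative_at_within)
    then have cont\<beta>: "continuous_on {T..} \<beta>" unfolding \<beta>_def by (intro continuous_intros) auto
    define S where "S = {t \<in> {T..}. \<beta> t \<le> V t}"
    assume "\<not> (N x t)\<^sup>2 \<le> M * exp (- (\<Gamma> t - \<Gamma> T) / 2)"
    then have "t \<in> S" using \<open>T \<le> t\<close> by (simp add: S_def \<beta>_def V_def)
    have bdd: "bdd_below S" unfolding S_def by (rule bdd_belowI[of _ T]) simp
    have "closed S" unfolding S_def by (rule continuous_on_closed_Collect_le[OF cont\<beta> contV]) simp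
    then have "Inf S \<in> S" using closed_contains_Inf[OF _ bdd] \<open>t \<in> S\<close> by blast
    define t' where "t' = Inf S"
    have t': "T \<le> t'" "\<beta> t' \<le> V t'" using \<open>Inf S \<in> S\<close> by (auto simp: S_def t'_def)
    have before: "V r < \<beta> r" if "T \<le> r" "r < t'" for r
      using cInf_lower[OF _ bdd, of r] that unfolding t'_def S_def by fastforce
    have "\<beta> T = M" by (simp add: \<beta>_def)
    moreover have "V T < M" using start taubar_pos by (simp add: V_def)
    ultimately have "T \<noteq> t'" using t'(2) by force
    then have "T < t'" using t'(1) by simp
    have t'0: "t' > 0" using \<open>T < t'\<close> T taubar_pos by simp
    have Vpos: "0 < V t'" using t'(2) \<beta>_pos[of t'] by linarith
    have \<beta>_win: "\<beta> r \<le> E * \<beta> t'" if "t' - 2 * taubar \<le> r" "r \<le> t'" for r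
    proof -
      have "\<Gamma> t' - \<Gamma> r \<le> (t' - r) * \<gamma> 0"
        using that \<open>T < t'\<close> T taubar_pos by (intro \<Gamma>_diff) auto
      also have "\<dots> \<le> (2 * taubar) * \<gamma> 0" using that \<gamma>_pos[of 0] by (intro mult_right_mono) auto
      finally have "exp (- (\<Gamma> r - \<Gamma> T) / 2) \<le> exp (taubar * \<gamma> 0 + - (\<Gamma> t' - \<Gamma> T) / 2)"
        unfolding exp_le_cancel_iff by (simp add: field_simps)
      then show ?thesis using M unfolding \<beta>_def E_def exp_add by simp
    qed
    define m where "m = sqrt (E * V t')"
    have m: "N x r \<le> m" if r: "r \<in> {t' - 2 * taubar..t'}" for r
    proof -
      have "V r \<le> E * V t'"
      proof (cases "r = t'")
        case True
        have "1 \<le> E" using taubar_pos \<gamma>_pos[of 0] by (simp add: E_def)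
        then show ?thesis using Vpos True by simp
      next
        case False
        have "V r \<le> \<beta> r"
        proof (cases "T \<le> r")
          case True
          then show ?thesis using before[of r] False r by simp
        next
          case False
          then have "V r < M" using start r \<open>T < t'\<close> by (auto simp: V_def)
          moreover have "M * 1 \<le> \<beta> r"
            unfolding \<beta>_def using M False r \<open>T < t'\<close> T taubar_pos \<Gamma>_diff(1)[of r T]
            by (intro mult_left_mono) auto
          ultimately show ?thesis by simp
        qed
        also have "\<dots> \<le> E * \<beta> t'" using \<beta>_win r by simp
        also have "\<dots> \<le> E * V t'" using t' E by simp
        finally show ?thesis .
      qed
      then show ?thesis unfolding m_def V_def by (rule real_le_rsqrt)
    qed
    have m2: "m\<^sup>2 = E * V t'" using E Vpos by (simp add: m_def)
    have "2 * (y x t' \<bullet> F x t') \<le> - \<gamma> t' * V t' + 1 / (4 * E) * \<gamma> t' * m\<^sup>2"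
      unfolding V_def using T0[OF _ sol, of t' m] m t' T by auto
    then have g': "2 * (y x t' \<bullet> F x t') \<le> - (3 / 4) * \<gamma> t' * V t'"
      using E by (simp add: m2 mult_ac)
    \<comment> \<open>Comparison function minus the touching minorant of \<open>V\<close>: positive
      just before \<open>t'\<close>, at most 0 at \<open>t'\<close>, and yet of positive derivative
      there.\<close>
    define f where "f = (\<lambda>s. \<beta> s - (2 * (y x t' \<bullet> x s) - V t'))"
    have "((\<lambda>s. y x t' \<bullet> x s) has_real_derivative y x t' \<bullet> F x t') (at t')"
      using bounded_linear.has_vector_derivative[OF bounded_linear_inner_right sol_deriv[OF sol]] \<open>T < t'\<close> T taubar_pos
      by (simp add: has_real_derivative_iff_has_vector_derivative)
    moreover have "(\<beta> has_real_derivative - (1 / 2) * \<gamma> t' * \<beta> t') (at t')"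
      unfolding \<beta>_def by (auto intro!: derivative_eq_intros \<Gamma>_deriv t'0)
    ultimately have f': "(f has_real_derivative (- (1 / 2) * \<gamma> t' * \<beta> t' - 2 * (y x t' \<bullet> F x t'))) (at t')"
      unfolding f_def by (auto intro!: derivative_eq_intros)
    have "\<gamma> t' * \<beta> t' \<le> \<gamma> t' * V t'" using t' \<gamma>_pos[of t'] t'0 by simp
    moreover have "0 < \<gamma> t' * V t'" using Vpos \<gamma>_pos[of t'] t'0 by simp
    ultimately have "0 < - (1 / 2) * \<gamma> t' * \<beta> t' - 2 * (y x t' \<bullet> F x t')" using g' by simp
    from DERIV_pos_inc_left[OF f' this] obtain \<delta> where \<delta>: "\<delta> > 0" "\<And>h. 0 < h \<Longrightarrow> h < \<delta> \<Longrightarrow> f (t' - h) < f t'"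
      by blast
    define h where "h = min (\<delta> / 2) (t' - T)"
    have h: "0 < h" "h < \<delta>" "T \<le> t' - h" using \<delta>(1) \<open>T < t'\<close> by (auto simp: h_def)
    have "V t' = x t' \<bullet> y x t'" using t'0 by (simp add: V_def N_power2)
    then have "f t' \<le> 0" using t'(2) by (simp add: f_def inner_commute)
    moreover have "0 < f (t' - h)"
      using before[of "t' - h"] touching_minorant[of "t' - h" t' x] h T taubar_pos
      by (simp add: f_def V_def)
    ultimately show False using \<delta>(2)[OF h(1,2)] by simp
  qed
  then show ?thesis using T by (intro exI[of _ T]) blast
qed

section \<open>Growth bounds on bounded time intervals\<close>

lemma control_gain: "\<exists>k>0. \<forall>t\<ge>0. \<forall>v. norm (K t *v v) \<le> k * norm v"
proof -
  obtain C where C: "C > 0" "\<And>g v. 0 < g \<Longrightarrow> g \<le> \<gamma> 0 \<Longrightarrow> norm (P g *v v) \<le> C\<^sup>2 * g * norm v"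
    using P_bounds[of "\<gamma> 0"] \<gamma>_pos by auto
  obtain c where c: "c > 0" "\<And>v. norm (transpose B *v v) \<le> c * norm v"
    using linear_bounded_pos[OF matrix_vector_mul_linear[of "transpose B"]] by (metis mult.commute)
  have "norm (K t *v v) \<le> c * C\<^sup>2 * \<gamma> 0 * norm v" if "t \<ge> 0" for t v
  proof -
    have "norm (K t *v v) \<le> c * norm (P (\<gamma> t) *v v)" using c(2) by (simp add: K_mult that)
    also have "\<dots> \<le> c * (C\<^sup>2 * \<gamma> t * norm v)"
      using c(1) that by (intro mult_left_mono C(2) \<gamma>_pos \<gamma>_le) auto
    also have "\<dots> \<le> c * (C\<^sup>2 * \<gamma> 0 * norm v)"
      using c(1) \<gamma>_le[OF that] by (intro mult_left_mono mult_right_mono) auto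
    finally show ?thesis by (simp add: mult_ac)
  qed
  moreover have "c * C\<^sup>2 * \<gamma> 0 > 0" using c C \<gamma>_pos[of 0] by simp
  ultimately show ?thesis by blast
qed

text \<open>Since the weight \<open>exp (l * r)\<close> increases, the weight at time
  \<open>s\<close> also covers all delayed values. The same bound drives the Gronwall argument and,
  with zero history, the contraction for existence.\<close>

lemma rhs_bound:
  "\<exists>L>0. \<exists>c>0. \<forall>u0 x U s m l. 0 \<le> s \<longrightarrow> 0 \<le> l \<longrightarrow> (\<forall>\<theta>\<in>{-taubar..<0}. norm (u0 \<theta>) \<le> U) \<longrightarrow>
    (\<forall>r\<in>{0..s}. norm (x r) \<le> m * exp (l * r)) \<longrightarrow> norm (rhs u0 x s) \<le> L * m * exp (l * s) + c * U"
proof -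
  obtain k where k: "k > 0" "\<And>t v. t \<ge> 0 \<Longrightarrow> norm (K t *v v) \<le> k * norm v" using control_gain by blast
  obtain \<beta> where \<beta>: "\<beta> > 0" "\<And>i u. i \<in> {1..q} \<Longrightarrow> norm (Bs i *v u) \<le> \<beta> * norm u" using Bs_bound by blast
  obtain a where a: "a > 0" "\<And>v. norm (A *v v) \<le> a * norm v"
    using linear_bounded_pos[OF matrix_vector_mul_linear[of A]] by (metis mult.commute)
  have "norm (rhs u0 x s) \<le> (a + real q * \<beta> * k) * m * exp (l * s) + (real q * \<beta> + 1) * U"
    if s: "0 \<le> s" and l: "0 \<le> l" and U: "\<forall>\<theta>\<in>{-taubar..<0}. norm (u0 \<theta>) \<le> U"
      and x: "\<forall>r\<in>{0..s}. norm (x r) \<le> m * exp (l * r)" for u0 x U s m l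
  proof -
    have "norm (u0 (- taubar)) \<le> U" using U taubar_pos by simp
    then have U0: "0 \<le> U" using norm_ge_zero order_trans by blast
    have "norm (x 0) \<le> m" using x[rule_format, of 0] s by simp
    then have m0: "0 \<le> m" using norm_ge_zero order_trans by blast
    have "norm (Bs i *v control K u0 x (s - tau i s)) \<le> \<beta> * (U + k * (m * exp (l * s)))"
      if i: "i \<in> {1..q}" for i
    proof -
      have "norm (control K u0 x (s - tau i s)) \<le> U + k * (m * exp (l * s))"
      proof (cases "s - tau i s < 0")
        case True
        then have "norm (u0 (s - tau i s)) \<le> U" using U tau_bounds[OF i s] s by auto
        then show ?thesis using True k(1) m0 by (simp add: control_def add_increasing2)
      next
        case False
        have "norm (K (s - tau i s) *v x (s - tau i s)) \<le> k * norm (x (s - tau i s))"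
          using k(2) False by simp
        also have "\<dots> \<le> k * (m * exp (l * (s - tau i s)))"
          using x False tau_bounds[OF i s] k(1) by (intro mult_left_mono) auto
        also have "\<dots> \<le> k * (m * exp (l * s))"
          using tau_bounds[OF i s] k(1) m0 l by (intro mult_left_mono) (auto intro: mult_left_mono)
        finally show ?thesis using False U0 by (simp add: control_def)
      qed
      then show ?thesis using \<beta>(2)[OF i] \<beta>(1) by (meson mult_left_mono less_imp_le order_trans)
    qed
    then have "norm (\<Sum>i=1..q. Bs i *v control K u0 x (s - tau i s)) \<le> real q * (\<beta> * (U + k * (m * exp (l * s))))"
      by (rule order_trans[OF sum_norm_bound[where K = "\<beta> * (U + k * (m * exp (l * s)))"]]) simp_all
    moreover have "norm (A *v x s) \<le> a * (m * exp (l * s))"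
      by (rule order_trans[OF a(2)]) (use x s a(1) in auto)
    ultimately have "norm (rhs u0 x s) \<le> a * (m * exp (l * s)) + real q * (\<beta> * (U + k * (m * exp (l * s))))"
      by (intro norm_triangle_le add_mono) auto
    then show ?thesis using U0 by (simp add: algebra_simps)
  qed
  moreover have "a + real q * \<beta> * k > 0" "real q * \<beta> + 1 > 0"
    using a(1) \<beta>(1) k(1) by (simp_all add: add_pos_nonneg add_nonneg_pos)
  ultimately show ?thesis by blast
qed

text \<open>Gronwall in weighted form: at the maximum \<open>t'\<close> of
  \<open>norm (x t) * exp (- l * t)\<close> the choice \<open>l = 2 * L\<close> makes the integral
  contribute at most half of the left side, which is absorbed.\<close>

lemma initial_bound:
  assumes "T \<ge> 0"
  shows "\<exists>C>0. \<forall>x0 u0 x U. sol x0 u0 x \<longrightarrow> (\<forall>\<theta>\<in>{-taubar..<0}. norm (u0 \<theta>) \<le> U) \<longrightarrow>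
    (\<forall>t\<in>{0..T}. norm (x t) \<le> C * (norm x0 + U))"
proof -
  obtain L c where Lc: "L > 0" "c > 0" "\<And>u0 x U s m l. 0 \<le> s \<Longrightarrow> 0 \<le> l \<Longrightarrow> (\<forall>\<theta>\<in>{-taubar..<0}. norm (u0 \<theta>) \<le> U) \<Longrightarrow>
    (\<forall>r\<in>{0..s}. norm (x r) \<le> m * exp (l * r)) \<Longrightarrow> norm (rhs u0 x s) \<le> L * m * exp (l * s) + c * U"
    using rhs_bound by blast
  define l where "l = 2 * L"
  have l: "l > 0" using Lc by (simp add: l_def)
  have "norm (x t) \<le> 2 * (1 + c * T) * exp (l * T) * (norm x0 + U)"
    if sol: "sol x0 u0 x" and U: "\<forall>\<theta>\<in>{-taubar..<0}. norm (u0 \<theta>) \<le> U" and t: "t \<in> {0..T}" for x0 u0 x U t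
  proof -
    have "norm (u0 (- taubar)) \<le> U" using U taubar_pos by simp
    then have U0: "0 \<le> U" using norm_ge_zero order_trans by blast
    have "continuous_on {0..T} x" by (rule continuous_on_subset[OF sol_continuous[OF sol]]) simp
    then have "continuous_on {0..T} (\<lambda>t. norm (x t) * exp (- l * t))" by (intro continuous_intros)
    then obtain t' where t': "t' \<in> {0..T}" "\<And>s. s \<in> {0..T} \<Longrightarrow> norm (x s) * exp (- l * s) \<le> norm (x t') * exp (- l * t')"
      using continuous_attains_sup[of "{0..T}" "\<lambda>t. norm (x t) * exp (- l * t)"] assms by auto
    define m where "m = norm (x t') * exp (- l * t')"
    have m0: "m \<ge> 0" by (simp add: m_def)
    have xm: "norm (x s) \<le> m * exp (l * s)" if "s \<in> {0..T}" for s
      using t'(2)[OF that] by (simp add: m_def exp_minus field_simps)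
    let ?g = "\<lambda>s. L * m * exp (l * s) + c * U"
    have int: "(?g has_integral (m / 2 * exp (l * t') + c * U * t') - (m / 2 * exp (l * 0) + c * U * 0)) {0..t'}"
      using t'(1) l
      by (intro fundamental_theorem_of_calculus)
        (auto intro!: derivative_eq_intros simp: l_def simp flip: has_real_derivative_iff_has_vector_derivative)
    have "norm (integral {0..t'} (rhs u0 x)) \<le> integral {0..t'} ?g"
    proof (rule integral_norm_bound_integral)
      show "rhs u0 x integrable_on {0..t'}" using sol_integrable[OF sol] t'(1) by simp
      show "?g integrable_on {0..t'}" using int by blast
      show "norm (rhs u0 x s) \<le> ?g s" if "s \<in> {0..t'}" for s
        using that t'(1) l xm by (intro Lc(3)[OF _ _ U]) auto
    qed
    also have "\<dots> = (m / 2 * exp (l * t') + c * U * t') - (m / 2)" using integral_unique[OF int] by simp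
    also have "\<dots> \<le> m / 2 * exp (l * t') + c * U * T"
    proof -
      have "c * U * t' \<le> c * U * T" using t'(1) Lc(2) U0 by (intro mult_left_mono) auto
      then show ?thesis using m0 by linarith
    qed
    finally have "norm (integral {0..t'} (rhs u0 x)) \<le> m / 2 * exp (l * t') + c * U * T" .
    then have "norm (x t') \<le> norm x0 + (m / 2 * exp (l * t') + c * U * T)"
      using sol_integral[OF sol, of t'] t'(1) norm_triangle_ineq[of x0 "integral {0..t'} (rhs u0 x)"] by simp
    moreover have "norm (x t') = m * exp (l * t')" by (simp add: m_def exp_minus)
    ultimately have "m * exp (l * t') / 2 \<le> norm x0 + c * U * T" by simp
    moreover have "m * 1 \<le> m * exp (l * t')" using m0 l t'(1) by (intro mult_left_mono) auto
    ultimately have "m \<le> 2 * (norm x0 + c * U * T)" by simp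
    also have "\<dots> \<le> 2 * (1 + c * T) * (norm x0 + U)"
      using assms Lc(2) U0 by (simp add: algebra_simps)
    finally have "m \<le> 2 * (1 + c * T) * (norm x0 + U)" .
    then have "m * exp (l * t) \<le> (2 * (1 + c * T) * (norm x0 + U)) * exp (l * T)"
      by (rule mult_mono) (use t l m0 assms Lc(2) U0 in auto)
    then show ?thesis using xm[OF t] by (simp add: mult_ac)
  qed
  moreover have "2 * (1 + c * T) * exp (l * T) > 0" using assms Lc(2) by (simp add: add_pos_nonneg)
  ultimately show ?thesis by blast
qed

text \<open>\<open>D\<close> is kept apart from \<open>norm x0 + U\<close> and positive, because the
  comparison argument needs a positive bound even for zero data. The function \<open>h\<close> is
  the same for all solutions, so both stability and attractivity follow from it.\<close>

lemma decay:
  "\<exists>h T. (h \<longlongrightarrow> 0) at_top \<and> 0 \<le> T \<and> (\<forall>x0 u0 x U D. sol x0 u0 x \<longrightarrow> (\<forall>\<theta>\<in>{-taubar..<0}. norm (u0 \<theta>) \<le> U) \<longrightarrow>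
     norm x0 + U \<le> D \<longrightarrow> 0 < D \<longrightarrow> (\<forall>t\<ge>T. (norm (x t))\<^sup>2 \<le> h t * D\<^sup>2))"
proof -
  have g0: "\<gamma> 0 > 0" by (simp add: \<gamma>_pos)
  obtain T where T: "T \<ge> 3 * taubar" and hal: "\<And>x0 u0 x M t. sol x0 u0 x \<Longrightarrow> 0 < M \<Longrightarrow>
      (\<forall>r\<in>{T - 2 * taubar..T}. (N x r)\<^sup>2 < M) \<Longrightarrow> T \<le> t \<Longrightarrow> (N x t)\<^sup>2 \<le> M * exp (- (\<Gamma> t - \<Gamma> T) / 2)"
    using halanay by blast
  have T0: "T \<ge> 0" using T taubar_pos by simp
  obtain C1 where C1: "C1 > 0" "\<And>x0 u0 x U t. sol x0 u0 x \<Longrightarrow> (\<forall>\<theta>\<in>{-taubar..<0}. norm (u0 \<theta>) \<le> U) \<Longrightarrow>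
      t \<in> {0..T} \<Longrightarrow> norm (x t) \<le> C1 * (norm x0 + U)"
    using initial_bound[OF T0] by blast
  obtain C2 where C2: "C2 > 0" "\<And>g v. 0 < g \<Longrightarrow> g \<le> \<gamma> 0 \<Longrightarrow> wnorm g (P g *v v) \<le> C2 * sqrt g * norm v"
    using P_bounds[OF g0] by blast
  obtain C3 p where C3: "C3 > 0" "\<And>g v. 0 < g \<Longrightarrow> g \<le> \<gamma> 0 \<Longrightarrow> (norm (W g *v v))\<^sup>2 \<le> C3 * (1 / g) ^ p * (wnorm g v)\<^sup>2"
    using W_upper[OF g0] by blast
  \<comment> \<open>The added 1 makes the initial inequality for the comparison strict.\<close>
  define k where "k = (C2 * sqrt (\<gamma> 0) * C1)\<^sup>2 + 1"
  have k: "k > 0" by (simp add: k_def add_nonneg_pos)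
  define h where "h = (\<lambda>t. C3 * k * exp (\<Gamma> T / 2) * ((1 / \<gamma> t) ^ p * exp (- \<Gamma> t / 2)))"
  have "(h \<longlongrightarrow> C3 * k * exp (\<Gamma> T / 2) * 0) at_top"
    unfolding h_def by (intro tendsto_intros \<Gamma>_dominates)
  then have hlim: "(h \<longlongrightarrow> 0) at_top" by simp
  have "(norm (x t))\<^sup>2 \<le> h t * D\<^sup>2"
    if sol: "sol x0 u0 x" and U: "\<forall>\<theta>\<in>{-taubar..<0}. norm (u0 \<theta>) \<le> U" and D: "norm x0 + U \<le> D" "0 < D"
      and t: "T \<le> t" for x0 u0 x U D t
  proof -
    have "(N x r)\<^sup>2 < k * D\<^sup>2" if r: "r \<in> {T - 2 * taubar..T}" for r
    proof -
      have r0: "0 \<le> r" using r T taubar_pos by simp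
      have "N x r \<le> C2 * sqrt (\<gamma> r) * norm (x r)"
        unfolding y_def by (intro C2 \<gamma>_pos \<gamma>_le r0)
      also have "\<dots> \<le> C2 * sqrt (\<gamma> 0) * (C1 * D)"
      proof (intro mult_mono mult_left_mono)
        have "norm (x r) \<le> C1 * (norm x0 + U)" using r r0 by (intro C1(2)[OF sol U]) auto
        then show "norm (x r) \<le> C1 * D" using D C1(1) by (meson mult_left_mono less_imp_le order_trans)
      qed (use \<gamma>_le[OF r0] \<gamma>_pos[OF r0] g0 C2(1) in auto)
      finally have "(N x r)\<^sup>2 \<le> (C2 * sqrt (\<gamma> 0) * (C1 * D))\<^sup>2"
        by (rule power_mono) (rule N_nonneg[OF r0])
      also have "\<dots> = (C2 * sqrt (\<gamma> 0) * C1)\<^sup>2 * D\<^sup>2" by (simp only: power_mult_distrib mult_ac)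
      also have "\<dots> < k * D\<^sup>2" using D(2) unfolding k_def by (intro mult_strict_right_mono) auto
      finally show ?thesis .
    qed
    then have V: "(N x t)\<^sup>2 \<le> k * D\<^sup>2 * exp (- (\<Gamma> t - \<Gamma> T) / 2)"
      using k D(2) t by (intro hal[OF sol]) auto
    have t0: "t \<ge> 0" using t T0 by simp
    have "(norm (x t))\<^sup>2 = (norm (W (\<gamma> t) *v y x t))\<^sup>2" by (simp add: W_y t0)
    also have "\<dots> \<le> C3 * (1 / \<gamma> t) ^ p * (N x t)\<^sup>2" by (intro C3 \<gamma>_pos \<gamma>_le t0)
    also have "\<dots> \<le> C3 * (1 / \<gamma> t) ^ p * (k * D\<^sup>2 * exp (- (\<Gamma> t - \<Gamma> T) / 2))"
      using V C3(1) \<gamma>_pos[OF t0] by (intro mult_left_mono) auto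
    also have "exp (- (\<Gamma> t - \<Gamma> T) / 2) = exp (\<Gamma> T / 2) * exp (- \<Gamma> t / 2)"
      by (simp add: diff_divide_distrib flip: exp_add)
    finally show ?thesis by (simp add: h_def mult_ac)
  qed
  with hlim T0 show ?thesis by blast
qed

section \<open>From uniform decay to stability and attractivity\<close>

lemma history_bound:
  assumes "admissible_history taubar u0"
  shows "\<forall>\<theta>\<in>{-taubar..<0}. norm (u0 \<theta>) \<le> (SUP \<theta>\<in>{-taubar..<0}. norm (u0 \<theta>))"
proof
  fix \<theta> assume "\<theta> \<in> {-taubar..<0}"
  moreover obtain a where "\<forall>\<theta>\<in>{-taubar..<0}. norm (u0 \<theta>) \<le> a"
    using assms by (auto simp: admissible_history_def bounded_iff)
  then have "bdd_above ((\<lambda>\<theta>. norm (u0 \<theta>)) ` {-taubar..<0})" by (intro bdd_aboveI2[where M = a]) auto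
  ultimately show "norm (u0 \<theta>) \<le> (SUP \<theta>\<in>{-taubar..<0}. norm (u0 \<theta>))" by (rule cSUP_upper)
qed

lemma lyapunov_stable:
  assumes "\<epsilon> > 0"
  shows "\<exists>\<delta>>0. \<forall>x0 u0 x. admissible_history taubar u0 \<longrightarrow> sol x0 u0 x \<longrightarrow>
    norm x0 + (SUP \<theta>\<in>{-taubar..<0}. norm (u0 \<theta>)) \<le> \<delta> \<longrightarrow> (\<forall>t\<ge>0. norm (x t) \<le> \<epsilon>)"
proof -
  obtain h T where h: "(h \<longlongrightarrow> 0) at_top" "0 \<le> T" and dec: "\<And>x0 u0 x U D t. sol x0 u0 x \<Longrightarrow>
      (\<forall>\<theta>\<in>{-taubar..<0}. norm (u0 \<theta>) \<le> U) \<Longrightarrow> norm x0 + U \<le> D \<Longrightarrow> 0 < D \<Longrightarrow> T \<le> t \<Longrightarrow> (norm (x t))\<^sup>2 \<le> h t * D\<^sup>2"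
    using decay by blast
  obtain T1 where T1: "\<And>t. T1 \<le> t \<Longrightarrow> h t < 1"
    using order_tendstoD(2)[OF h(1), of 1] by (auto simp: eventually_at_top_linorder)
  define T' where "T' = max T T1"
  have T': "T' \<ge> 0" "T \<le> T'" "T1 \<le> T'" using h(2) by (auto simp: T'_def)
  obtain C where C: "C > 0" "\<And>x0 u0 x U t. sol x0 u0 x \<Longrightarrow> (\<forall>\<theta>\<in>{-taubar..<0}. norm (u0 \<theta>) \<le> U) \<Longrightarrow>
      t \<in> {0..T'} \<Longrightarrow> norm (x t) \<le> C * (norm x0 + U)"
    using initial_bound[OF T'(1)] by blast
  \<comment> \<open>The first bound serves times after \<open>T'\<close>, where
    \<open>h < 1\<close>; the second serves the interval up to \<open>T'\<close>.\<close>
  define \<delta> where "\<delta> = min \<epsilon> (\<epsilon> / C)"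
  have \<delta>: "\<delta> > 0" "\<delta> \<le> \<epsilon>" "C * \<delta> \<le> \<epsilon>"
    using assms C(1) by (auto simp: \<delta>_def min_def field_simps)
  have "norm (x t) \<le> \<epsilon>" if adm: "admissible_history taubar u0" and sol: "sol x0 u0 x"
    and D: "norm x0 + (SUP \<theta>\<in>{-taubar..<0}. norm (u0 \<theta>)) \<le> \<delta>" and t: "t \<ge> 0" for x0 u0 x t
  proof (cases "t \<le> T'")
    case True
    then have "norm (x t) \<le> C * (norm x0 + (SUP \<theta>\<in>{-taubar..<0}. norm (u0 \<theta>)))"
      using t by (intro C(2)[OF sol history_bound[OF adm]]) simp
    also have "\<dots> \<le> C * \<delta>" using D C(1) by simp
    finally show ?thesis using \<delta> by simp
  next
    case False
    then have "(norm (x t))\<^sup>2 \<le> h t * \<delta>\<^sup>2"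
      using T' by (intro dec[OF sol history_bound[OF adm] D \<delta>(1)]) simp
    also have "\<dots> \<le> 1 * \<delta>\<^sup>2" using T1[of t] False T' by (intro mult_right_mono) auto
    finally have "norm (x t) \<le> \<delta>" using \<delta>(1) by (simp add: power2_le_iff_abs_le)
    then show ?thesis using \<delta> by simp
  qed
  with \<delta>(1) show ?thesis by blast
qed

lemma attractive:
  assumes "admissible_history taubar u0" "sol x0 u0 x"
  shows "((\<lambda>t. norm (x t)) \<longlongrightarrow> 0) at_top"
proof -
  obtain h T where h: "(h \<longlongrightarrow> 0) at_top" and dec: "\<And>x0 u0 x U D t. sol x0 u0 x \<Longrightarrow>
      (\<forall>\<theta>\<in>{-taubar..<0}. norm (u0 \<theta>) \<le> U) \<Longrightarrow> norm x0 + U \<le> D \<Longrightarrow> 0 < D \<Longrightarrow> T \<le> t \<Longrightarrow> (norm (x t))\<^sup>2 \<le> h t * D\<^sup>2"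
    using decay by blast
  define D where "D = \<bar>norm x0 + (SUP \<theta>\<in>{-taubar..<0}. norm (u0 \<theta>))\<bar> + 1"
  have "((\<lambda>t. h t * D\<^sup>2) \<longlongrightarrow> 0) at_top" using tendsto_mult_left_zero[OF h] .
  moreover have "\<forall>\<^sub>F t in at_top. norm ((norm (x t))\<^sup>2) \<le> h t * D\<^sup>2"
    unfolding eventually_at_top_linorder
    using dec[OF assms(2) history_bound[OF assms(1)], of D] by (intro exI[of _ T]) (auto simp: D_def)
  ultimately have "((\<lambda>t. (norm (x t))\<^sup>2) \<longlongrightarrow> 0) at_top" by (rule Lim_null_comparison[rotated])
  then have "((\<lambda>t. sqrt ((norm (x t))\<^sup>2)) \<longlongrightarrow> sqrt 0) at_top" by (rule tendsto_real_sqrt)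
  then show ?thesis by simp
qed

end


section \<open>Existence of solutions\<close>

text \<open>An expanding map has a Lipschitz inverse, which sends null sets to null sets.\<close>

lemma measurable_compose_expanding:
  fixes \<phi> :: "real \<Rightarrow> real" and w :: "real \<Rightarrow> 'b::euclidean_space"
  assumes w: "w \<in> borel_measurable lebesgue" and \<phi>: "continuous_on {0..T} \<phi>"
    and "c > 0" and expand: "\<And>r s. 0 \<le> r \<Longrightarrow> r \<le> s \<Longrightarrow> s \<le> T \<Longrightarrow> c * (s - r) \<le> \<phi> s - \<phi> r"
  shows "(\<lambda>s. w (\<phi> s)) \<in> borel_measurable (lebesgue_on {0..T})"
proof (rule borel_measurableI)
  fix Y :: "'b set" assume "open Y"
  have inj: "inj_on \<phi> {0..T}"
  proof (rule linorder_inj_onI')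
    fix r s assume "r \<in> {0..T}" "s \<in> {0..T}" "r < s"
    then have "0 < c * (s - r)" "c * (s - r) \<le> \<phi> s - \<phi> r" using expand[of r s] \<open>c > 0\<close> by auto
    then show "\<phi> r \<noteq> \<phi> s" by linarith
  qed
  define \<psi> where "\<psi> = the_inv_into {0..T} \<phi>"
  have \<psi>: "\<psi> (\<phi> s) = s" if "s \<in> {0..T}" for s
    unfolding \<psi>_def using the_inv_into_f_f[OF inj that] .
  have lip: "norm (\<psi> v - \<psi> u) \<le> (1 / c) * norm (v - u)" if "u \<in> \<phi> ` {0..T}" "v \<in> \<phi> ` {0..T}" for u v
  proof -
    from that obtain r s where rs: "r \<in> {0..T}" "s \<in> {0..T}" "u = \<phi> r" "v = \<phi> s" by blast
    have "c * \<bar>s - r\<bar> \<le> \<bar>\<phi> s - \<phi> r\<bar>"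
    proof (cases "r \<le> s")
      case True
      then show ?thesis using expand[of r s] rs by simp
    next
      case False
      then show ?thesis using expand[of s r] rs by (simp add: abs_if not_le split: if_splits)
    qed
    then show ?thesis using rs \<psi> \<open>c > 0\<close> by (simp add: field_simps)
  qed
  have cont: "continuous_on (\<phi> ` {0..T}) \<psi>"
    unfolding \<psi>_def by (rule continuous_on_inv_into[OF \<phi> compact_Icc inj])
  have "w -` Y \<inter> space lebesgue \<in> sets lebesgue" by (rule measurable_sets[OF w]) (simp add: \<open>open Y\<close>)
  moreover have "compact (\<phi> ` {0..T})" by (intro compact_continuous_image \<phi>) auto
  ultimately have X: "\<phi> ` {0..T} \<inter> w -` Y \<in> sets lebesgue"
    by (auto simp: lmeasurable_compact fmeasurableD)
  have "\<psi> ` (\<phi> ` {0..T} \<inter> w -` Y) \<in> sets lebesgue"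
  proof (rule sets_lebesgue_continuous_image[OF X cont])
    fix S :: "real set"
    assume "negligible S" "S \<subseteq> \<phi> ` {0..T}"
    show "negligible (\<psi> ` S)"
    proof (rule negligible_locally_Lipschitz_image[OF _ \<open>negligible S\<close>])
      fix u assume "u \<in> S"
      then show "\<exists>V M. open V \<and> u \<in> V \<and> (\<forall>v\<in>S \<inter> V. norm (\<psi> v - \<psi> u) \<le> M * norm (v - u))"
        using \<open>S \<subseteq> \<phi> ` {0..T}\<close>
        by (intro exI[of _ UNIV] exI[of _ "1 / c"] conjI ballI lip) auto
    qed simp
  qed simp
  moreover have "\<psi> ` (\<phi> ` {0..T} \<inter> w -` Y) = (\<lambda>s. w (\<phi> s)) -` Y \<inter> {0..T}"
    using \<psi> by force
  ultimately show "(\<lambda>s. w (\<phi> s)) -` Y \<inter> space (lebesgue_on {0..T}) \<in> sets (lebesgue_on {0..T})"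
    by (simp add: sets_restrict_space_iff)
qed

text \<open>Integration in the exponentially weighted norm gains the factor \<open>1 / l\<close>,
  the source of the contraction constant.\<close>

lemma norm_integral_exp_bound:
  fixes f :: "real \<Rightarrow> 'a::euclidean_space"
  assumes "f integrable_on {0..t}" and "0 < l" "0 \<le> t" "0 \<le> M"
    and "\<And>s. s \<in> {0..t} \<Longrightarrow> norm (f s) \<le> M * exp (l * s)"
  shows "norm (integral {0..t} f) \<le> M / l * exp (l * t)"
proof -
  have int: "((\<lambda>s. M * exp (l * s)) has_integral M / l * exp (l * t) - M / l * exp (l * 0)) {0..t}"
    using assms(2,3) by (intro fundamental_theorem_of_calculus)
      (auto intro!: derivative_eq_intros simp flip: has_real_derivative_iff_has_vector_derivative)
  have "norm (integral {0..t} f) \<le> integral {0..t} (\<lambda>s. M * exp (l * s))"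
    using int assms(1,5) by (intro integral_norm_bound_integral) auto
  also have "\<dots> = M / l * exp (l * t) - M / l" using integral_unique[OF int] by simp
  also have "\<dots> \<le> M / l * exp (l * t)" using assms(2,4) by simp
  finally show ?thesis .
qed

context delay_system
begin

text \<open>The right-hand side is affine in the pair of history and state, so its Lipschitz
  estimate is \<open>rhs_bound\<close> with \<open>U = 0\<close>.\<close>

lemma rhs_diff: "rhs u0 x s - rhs u0 x' s = rhs (\<lambda>_. 0) (\<lambda>r. x r - x' r) s"
proof -
  have "control K u0 x r - control K u0 x' r = control K (\<lambda>_. 0) (\<lambda>r. x r - x' r) r" for r
    by (simp add: control_def matrix_vector_mult_diff_distrib)
  then have "(\<Sum>i=1..q. Bs i *v control K u0 x (s - tau i s)) - (\<Sum>i=1..q. Bs i *v control K u0 x' (s - tau i s))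
      = (\<Sum>i=1..q. Bs i *v control K (\<lambda>_. 0) (\<lambda>r. x r - x' r) (s - tau i s))"
    by (simp flip: sum_subtractf matrix_vector_mult_diff_distrib)
  then show ?thesis by (simp add: matrix_vector_mult_diff_distrib algebra_simps)
qed

lemma rhs_absolutely_integrable:
  assumes adm: "admissible_history taubar u0" and x: "continuous_on {0..} x" and "0 \<le> T"
    and "c > 0" and expand: "\<And>i r s. i \<in> {1..q} \<Longrightarrow> 0 \<le> r \<Longrightarrow> r \<le> s \<Longrightarrow> c * (s - r) \<le> (s - tau i s) - (r - tau i r)"
  shows "rhs u0 x absolutely_integrable_on {0..T}"
proof -
  have sub: "{0..T} \<subseteq> {0..}" by auto
  obtain U where U: "\<forall>\<theta>\<in>{-taubar..<0}. norm (u0 \<theta>) \<le> U" using history_bound[OF adm] by blast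
  have "norm (u0 (- taubar)) \<le> U" using U taubar_pos by simp
  obtain m where m: "\<forall>r\<in>{0..T}. norm (x r) \<le> m"
    using compact_imp_bounded[OF compact_continuous_image[OF continuous_on_subset[OF x sub] compact_Icc]]
    by (auto simp: bounded_iff)
  obtain L c' where Lc: "\<And>u0 x U s m l. 0 \<le> s \<Longrightarrow> 0 \<le> l \<Longrightarrow> (\<forall>\<theta>\<in>{-taubar..<0}. norm (u0 \<theta>) \<le> U) \<Longrightarrow>
    (\<forall>r\<in>{0..s}. norm (x r) \<le> m * exp (l * r)) \<Longrightarrow> norm (rhs u0 x s) \<le> L * m * exp (l * s) + c' * U"
    using rhs_bound by blast
  have lin: "(\<lambda>s. M *v f s) \<in> borel_measurable (lebesgue_on {0..T})"
    if "f \<in> borel_measurable (lebesgue_on {0..T})" for M :: "real^'k^'n" and f :: "real \<Rightarrow> real^'k"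
    by (rule borel_measurable_continuous_on[OF _ that])
      (intro linear_continuous_on matrix_vector_mul_bounded_linear)
  \<comment> \<open>Extension by zero is measurable on the whole line, and negative delayed times
    stay in the history interval, where \<open>w\<close> agrees with \<open>u0\<close>.\<close>
  define w where "w = (\<lambda>r. if r \<in> {-taubar..<0} then u0 r else 0)"
  have w: "w \<in> borel_measurable lebesgue"
    unfolding w_def using adm by (subst borel_measurable_if) (auto simp: admissible_history_def)
  have meas: "(\<lambda>s. control K u0 x (s - tau i s)) \<in> borel_measurable (lebesgue_on {0..T})"
    if i: "i \<in> {1..q}" for i
  proof -
    let ?\<phi> = "\<lambda>s. s - tau i s"
    have \<phi>: "continuous_on {0..T} ?\<phi>"
      by (intro continuous_intros continuous_on_subset[OF tau_continuous[OF i] sub])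
    \<comment> \<open>Clipping at 0 keeps the argument where \<open>y x\<close> is continuous and
      changes no value in the branch that uses it.\<close>
    have "continuous_on {0..T} (\<lambda>s. - (transpose B *v y x (max 0 (?\<phi> s))))"
      by (intro continuous_intros linear_continuous_on_compose[OF _ matrix_vector_mul_linear]
          continuous_on_compose2[OF y_continuous[OF x]] \<phi>) auto
    then have 1: "(\<lambda>s. - (transpose B *v y x (max 0 (?\<phi> s)))) \<in> borel_measurable (lebesgue_on {0..T})"
      by (rule continuous_imp_measurable_on_sets_lebesgue) simp
    have 2: "(\<lambda>s. w (?\<phi> s)) \<in> borel_measurable (lebesgue_on {0..T})"
      by (rule measurable_compose_expanding[OF w \<phi> \<open>c > 0\<close>]) (use expand[OF i] in auto)
    have "?\<phi> \<in> borel_measurable (lebesgue_on {0..T})"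
      by (rule continuous_imp_measurable_on_sets_lebesgue[OF \<phi>]) simp
    then have 3: "{s \<in> space (lebesgue_on {0..T}). ?\<phi> s < 0} \<in> sets (lebesgue_on {0..T})"
      by measurable
    have "(\<lambda>s. if ?\<phi> s < 0 then w (?\<phi> s) else - (transpose B *v y x (max 0 (?\<phi> s)))) \<in> borel_measurable (lebesgue_on {0..T})"
      by (rule measurable_If[OF 2 1 3])
    moreover have "(if ?\<phi> s < 0 then w (?\<phi> s) else - (transpose B *v y x (max 0 (?\<phi> s)))) = control K u0 x (?\<phi> s)"
      if "s \<in> space (lebesgue_on {0..T})" for s
      using that tau_bounds[OF i, of s] by (auto simp: control_eq w_def)
    ultimately show ?thesis by (rule measurable_cong[THEN iffD1, rotated])
  qed
  show ?thesis
  proof (rule measurable_bounded_by_integrable_imp_absolutely_integrable)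
    show "rhs u0 x \<in> borel_measurable (lebesgue_on {0..T})"
      by (intro borel_measurable_add borel_measurable_sum lin meas
          continuous_imp_measurable_on_sets_lebesgue continuous_on_subset[OF x sub]) auto
    show "(\<lambda>s. L * m + c' * U) integrable_on {0..T}" by (rule integrable_const_ivl)
    show "norm (rhs u0 x s) \<le> L * m + c' * U" if "s \<in> {0..T}" for s
      using Lc[OF _ order_refl U, of s x m] that m by simp
  qed simp
qed

text \<open>Picard iteration for the unknown \<open>z s = exp (- l * s) *\<^sub>R x s\<close> in the
  space of bounded continuous functions. With \<open>l = 2 * L\<close> the map contracts by 1/2 on
  the whole half-line, so a global solution arises without continuation of local ones.\<close>

lemma solution_exists:
  assumes adm: "admissible_history taubar u0"
    and "c > 0" and expand: "\<And>i r s. i \<in> {1..q} \<Longrightarrow> 0 \<le> r \<Longrightarrow> r \<le> s \<Longrightarrow> c * (s - r) \<le> (s - tau i s) - (r - tau i r)"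
  shows "\<exists>x. sol x0 u0 x"
proof -
  obtain U where U: "\<forall>\<theta>\<in>{-taubar..<0}. norm (u0 \<theta>) \<le> U" using history_bound[OF adm] by blast
  have "norm (u0 (- taubar)) \<le> U" using U taubar_pos by simp
  then have U0: "0 \<le> U" using norm_ge_zero order_trans by blast
  obtain L c' where L: "L > 0" "c' > 0" "\<And>u0 x U s m l. 0 \<le> s \<Longrightarrow> 0 \<le> l \<Longrightarrow> (\<forall>\<theta>\<in>{-taubar..<0}. norm (u0 \<theta>) \<le> U) \<Longrightarrow>
    (\<forall>r\<in>{0..s}. norm (x r) \<le> m * exp (l * r)) \<Longrightarrow> norm (rhs u0 x s) \<le> L * m * exp (l * s) + c' * U"
    using rhs_bound by blast
  define l where "l = 2 * L"
  have l: "l > 0" using L by (simp add: l_def)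
  define X where "X = (\<lambda>(z :: real \<Rightarrow>\<^sub>C (real^'n)) s. exp (l * s) *\<^sub>R apply_bcontfun z s)"
  define J where "J = (\<lambda>z t. integral {0..t} (rhs u0 (X z)))"
  \<comment> \<open>The function space lives on the whole real line; \<open>max 0 t\<close> extends
    the iterate constantly to negative times.\<close>
  define \<Phi> where "\<Phi> = (\<lambda>z t. exp (- l * max 0 t) *\<^sub>R (x0 + J z (max 0 t)))"
  have contX: "continuous_on {0..} (X z)" for z
    unfolding X_def by (intro continuous_intros continuous_on_apply_bcontfun)
  have absint: "rhs u0 (X z) absolutely_integrable_on {0..T}" if "0 \<le> T" for z T
    by (rule rhs_absolutely_integrable[OF adm contX that assms(2) expand])
  then have int: "rhs u0 (X z) integrable_on {0..T}" if "0 \<le> T" for z T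
    using that by (blast dest: set_lebesgue_integral_eq_integral(1))
  have contJ: "continuous_on {0..} (J z)" for z
    unfolding J_def by (intro continuous_on_atLeast indefinite_integral_continuous_1 int)
  have cont: "continuous_on UNIV (\<Phi> z)" for z
    unfolding \<Phi>_def
    by (intro continuous_intros continuous_on_compose2[OF contJ]) auto
  have bound: "norm (\<Phi> z t) \<le> norm x0 + (L * norm z + c' * U) / l" for z t
  proof -
    define t' where "t' = max 0 t"
    have t': "t' \<ge> 0" by (simp add: t'_def)
    have "norm (J z t') \<le> (L * norm z + c' * U) / l * exp (l * t')"
      unfolding J_def
    proof (rule norm_integral_exp_bound[OF int[OF t'] l t'])
      show "0 \<le> L * norm z + c' * U" using L U0 by simp
      fix s assume s: "s \<in> {0..t'}"
      have "norm (X z r) \<le> norm z * exp (l * r)" for r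
        using norm_bounded[of z r] by (simp add: X_def mult.commute)
      then have "norm (rhs u0 (X z) s) \<le> L * norm z * exp (l * s) + c' * U"
        using s l by (intro L(3)[OF _ _ U]) auto
      moreover have "c' * U * 1 \<le> c' * U * exp (l * s)" using L U0 s l by (intro mult_left_mono) auto
      ultimately show "norm (rhs u0 (X z) s) \<le> (L * norm z + c' * U) * exp (l * s)" by (simp add: algebra_simps)
    qed
    then have "exp (- l * t') * norm (J z t') \<le> exp (- l * t') * ((L * norm z + c' * U) / l * exp (l * t'))"
      by (intro mult_left_mono) auto
    also have "\<dots> = (L * norm z + c' * U) / l" by (simp add: exp_minus)
    finally have 1: "exp (- l * t') * norm (J z t') \<le> (L * norm z + c' * U) / l" .
    have "exp (- l * t') * norm x0 \<le> 1 * norm x0" using l t' by (intro mult_right_mono) auto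
    moreover have "norm (\<Phi> z t) \<le> exp (- l * t') * norm x0 + exp (- l * t') * norm (J z t')"
      unfolding \<Phi>_def t'_def[symmetric]
      by (simp add: norm_triangle_ineq flip: distrib_left)
    ultimately show ?thesis using 1 by linarith
  qed
  define \<Psi> where "\<Psi> = (\<lambda>z. Bcontfun (\<Phi> z))"
  have \<Psi>: "apply_bcontfun (\<Psi> z) = \<Phi> z" for z
    unfolding \<Psi>_def by (rule Bcontfun_inverse[OF bcontfun_normI[OF cont bound]])
  have "dist (\<Psi> z) (\<Psi> z') \<le> 1 / 2 * dist z z'" for z z'
  proof (rule dist_bound)
    fix t :: real
    define t' where "t' = max 0 t"
    have t': "t' \<ge> 0" by (simp add: t'_def)
    have "norm (integral {0..t'} (\<lambda>s. rhs u0 (X z) s - rhs u0 (X z') s)) \<le> (L * dist z z') / l * exp (l * t')"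
    proof (rule norm_integral_exp_bound[OF integrable_diff[OF int[OF t'] int[OF t']] l t'])
      show "0 \<le> L * dist z z'" using L by simp
      fix s assume s: "s \<in> {0..t'}"
      have "norm (X z r - X z' r) \<le> dist z z' * exp (l * r)" for r
        using dist_bounded[of z r z']
        by (simp add: X_def dist_norm mult.commute flip: scaleR_diff_right)
      then have "norm (rhs (\<lambda>_. 0) (\<lambda>r. X z r - X z' r) s) \<le> L * dist z z' * exp (l * s) + c' * 0"
        using s l by (intro L(3)) auto
      then show "norm (rhs u0 (X z) s - rhs u0 (X z') s) \<le> L * dist z z' * exp (l * s)"
        by (simp only: rhs_diff)
    qed
    then have "exp (- l * t') * norm (J z t' - J z' t') \<le> exp (- l * t') * ((L * dist z z') / l * exp (l * t'))"
      unfolding J_def integral_diff[OF int[OF t'] int[OF t']] by (intro mult_left_mono) auto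
    also have "\<dots> = 1 / 2 * dist z z'" using L by (simp add: exp_minus l_def)
    finally show "dist (apply_bcontfun (\<Psi> z) t) (apply_bcontfun (\<Psi> z') t) \<le> 1 / 2 * dist z z'"
      unfolding \<Psi> \<Phi>_def t'_def[symmetric] dist_norm
      by (simp flip: scaleR_diff_right)
  qed
  then obtain z where z: "\<Psi> z = z"
    using banach_fix_type[of "1 / 2" \<Psi>] by auto
  have sol: "X z t = x0 + J z t" if "t \<ge> 0" for t
  proof -
    have "apply_bcontfun z t = exp (- l * t) *\<^sub>R (x0 + J z t)"
      using fun_cong[OF \<Psi>[of z, unfolded z], of t] that by (simp add: \<Phi>_def)
    then show ?thesis by (simp add: X_def exp_minus)
  qed
  have X0: "X z 0 = x0" using sol[of 0] by (simp add: J_def)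
  have "sol x0 u0 (X z)"
    unfolding sol_def closed_loop_solution_def integral_curve_def
    using X0 absint sol by (auto simp: J_def)
  then show ?thesis by blast
qed

end


section \<open>Power-law gains\<close>

lemma power_law_gain_slow:
  fixes \<gamma> :: "real \<Rightarrow> real"
  assumes \<gamma>: "\<And>t. t \<ge> 0 \<Longrightarrow> \<gamma> t = c / (w * t + 1) powr \<mu>"
    and "c > 0" and "w > 0" and "0 < \<mu>" and "\<mu> < 1"
  shows "slow_gain \<gamma> (\<lambda>t. c / (w * (1 - \<mu>)) * (w * t + 1) powr (1 - \<mu>))"
proof
  have base: "w * t + 1 > 0" if "t \<ge> 0" for t using that assms(3) by (simp add: add_nonneg_pos)
  fix s t :: real
  show "t \<ge> 0 \<Longrightarrow> \<gamma> t > 0" using \<gamma>[of t] base[of t] \<open>c > 0\<close> by simp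
  show "\<gamma> t \<le> \<gamma> s" if "0 \<le> s" "s \<le> t"
    using that \<gamma>[of s] \<gamma>[of t] base[of s] base[of t] assms
    by (auto intro!: divide_left_mono powr_mono2 mult_pos_pos)
  have "continuous_on {0..} (\<lambda>t. c / (w * t + 1) powr \<mu>)"
    using base by (intro continuous_intros) (auto simp: less_imp_neq[symmetric])
  then show "continuous_on {0..} \<gamma>" by (rule continuous_on_eq) (simp add: \<gamma>)
  have ev: "\<forall>\<^sub>F t in at_top. \<gamma> t = c / (w * t + 1) powr \<mu>"
    using eventually_ge_at_top[of 0] by eventually_elim (rule \<gamma>)
  have "((\<lambda>t. c / (w * t + 1) powr \<mu>) \<longlongrightarrow> 0) at_top" using assms by real_asymp
  then show "(\<gamma> \<longlongrightarrow> 0) at_top" by (rule Lim_transform_eventually) (use ev in \<open>auto elim: eventually_mono\<close>)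
  show "\<forall>\<^sub>F t in at_top. \<gamma> (t - h) \<le> (1 + e) * \<gamma> t" if "e > 0" for e h
  proof -
    have "((\<lambda>t. (w * t + 1) powr \<mu> / (w * (t - h) + 1) powr \<mu>) \<longlongrightarrow> 1) at_top" using assms by real_asymp
    then have "\<forall>\<^sub>F t in at_top. (w * t + 1) powr \<mu> / (w * (t - h) + 1) powr \<mu> < 1 + e"
      using \<open>e > 0\<close> by (intro order_tendstoD(2)) auto
    with eventually_ge_at_top[of "max 0 h"] show ?thesis
    proof eventually_elim
      case (elim t)
      then have p: "(w * t + 1) powr \<mu> > 0" "(w * (t - h) + 1) powr \<mu> > 0"
        using base[of t] base[of "t - h"] by auto
      with elim have "(w * t + 1) powr \<mu> \<le> (1 + e) * (w * (t - h) + 1) powr \<mu>" by (simp add: field_simps)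
      then have "c * (w * t + 1) powr \<mu> \<le> c * ((1 + e) * (w * (t - h) + 1) powr \<mu>)"
        using \<open>c > 0\<close> by simp
      then have "c / (w * (t - h) + 1) powr \<mu> \<le> (1 + e) * (c / (w * t + 1) powr \<mu>)"
        using p by (simp add: field_simps)
      then show ?case using elim by (simp add: \<gamma>)
    qed
  qed
  show "((\<lambda>t. c / (w * (1 - \<mu>)) * (w * t + 1) powr (1 - \<mu>)) has_real_derivative \<gamma> t) (at t)" if "t > 0"
  proof -
    have "((\<lambda>t. c / (w * (1 - \<mu>)) * (w * t + 1) powr (1 - \<mu>)) has_real_derivative
        c / (w * (1 - \<mu>)) * ((1 - \<mu>) * (w * t + 1) powr (1 - \<mu> - 1) * w)) (at t)"
      using base[of t] that by (intro derivative_eq_intros DERIV_powr refl | simp)+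
    moreover have "c / (w * (1 - \<mu>)) * ((1 - \<mu>) * (w * t + 1) powr (1 - \<mu> - 1) * w) = \<gamma> t"
      using that assms by (simp add: \<gamma> powr_minus_divide)
    ultimately show ?thesis by simp
  qed
  fix p :: nat
  \<comment> \<open>\<open>k * (w * t + 1) powr (1 - \<mu>)\<close> is half of \<Gamma>. As
    \<open>1 - \<mu> > 0\<close>, this stretched exponential beats every power of
    \<open>1 / \<gamma>\<close>.\<close>
  define k where "k = c / (w * (1 - \<mu>)) / 2"
  have k: "k > 0" using assms by (simp add: k_def)
  have "((\<lambda>t. (1 / c) ^ p * ((w * t + 1) powr (\<mu> * p) * exp (- (k * (w * t + 1) powr (1 - \<mu>))))) \<longlongrightarrow> 0) at_top"
    using assms k by real_asymp
  moreover have "\<forall>\<^sub>F t in at_top. (1 / c) ^ p * ((w * t + 1) powr (\<mu> * p) * exp (- (k * (w * t + 1) powr (1 - \<mu>))))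
      = (1 / \<gamma> t) ^ p * exp (- (c / (w * (1 - \<mu>)) * (w * t + 1) powr (1 - \<mu>)) / 2)"
    using eventually_ge_at_top[of 0]
  proof eventually_elim
    case (elim t)
    have "(1 / \<gamma> t) ^ p = (1 / c) ^ p * ((w * t + 1) powr \<mu>) ^ p"
      using elim by (simp add: \<gamma> power_divide)
    also have "((w * t + 1) powr \<mu>) ^ p = (w * t + 1) powr (\<mu> * p)"
      using base[OF elim] by (simp add: powr_powr flip: powr_realpow)
    finally show ?case by (simp add: k_def)
  qed
  ultimately show "((\<lambda>t. (1 / \<gamma> t) ^ p * exp (- (c / (w * (1 - \<mu>)) * (w * t + 1) powr (1 - \<mu>)) / 2)) \<longlongrightarrow> 0) at_top"
    by (rule Lim_transform_eventually)
qed

theorem theorem1: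
  fixes A :: "real^'n^'n" and Bs :: "nat \<Rightarrow> real^'m^'n" and B :: "real^'m^'n" and q :: nat
    and tau :: "nat \<Rightarrow> real \<Rightarrow> real" and taubar d \<gamma>0 \<omega> \<mu> :: real and \<gamma> :: "real \<Rightarrow> real"
  assumes "B = (\<Sum>i=1..q. Bs i)"
    and "controllable A B"
    and "\<forall>z. eigenvalue A z \<longrightarrow> z = 0"
    and "taubar > 0" and "0 \<le> d" and "d < 1"
    and "\<forall>i\<in>{1..q}. \<forall>t\<ge>0. 0 \<le> tau i t \<and> tau i t \<le> taubar"
    and "\<forall>i\<in>{1..q}. \<forall>t\<ge>0. \<exists>D. (tau i has_real_derivative D) (at t within {0..}) \<and> D \<le> d"
    and "\<gamma>0 > 0" and "\<omega> > 0" and "0 < \<mu>" and "\<mu> < 1"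
    and "\<forall>t\<ge>0. \<gamma> t = \<gamma>0 / (\<omega> * t + 1) powr \<mu>"
  shows "closed_loop_asymptotically_stable A q Bs tau taubar
           (\<lambda>t. - (transpose B ** ple_solution A B (\<gamma> t)))"
proof -
  obtain n where n: "\<And>v. ((*v) A ^^ n) v = 0"
    using nilpotent_if_eigenvalues_zero[OF assms(3)] by blast
  have tau_cont: "continuous_on {0..} (tau i)" if "i \<in> {1..q}" for i
    unfolding continuous_on_eq_continuous_within
    using assms(8) that by (meson DERIV_continuous atLeast_iff)
  define \<Gamma> where "\<Gamma> = (\<lambda>t. \<gamma>0 / (\<omega> * (1 - \<mu>)) * (\<omega> * t + 1) powr (1 - \<mu>))"
  interpret slow_gain \<gamma> \<Gamma>
    unfolding \<Gamma>_def by (rule power_law_gain_slow) (use assms in auto)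
  interpret delay_system A B n \<gamma> \<Gamma> q Bs tau taubar
  proof
    show "((*v) A ^^ n) v = 0" for v by (rule n)
    show "transpose A *v w = 0 \<Longrightarrow> transpose B *v w = 0 \<Longrightarrow> w = 0" for w
      by (rule controllable_imp_no_common_kernel[OF assms(2)])
  qed (use assms tau_cont in auto)
  \<comment> \<open>By the mean value theorem a delay grows by at most \<open>d * (s - r)\<close>,
    so \<open>d < 1\<close> gives the positive expansion constant \<open>1 - d\<close>.\<close>
  have expand: "(1 - d) * (s - r) \<le> (s - tau i s) - (r - tau i r)"
    if i: "i \<in> {1..q}" and "0 \<le> r" "r \<le> s" for i r s
  proof -
    obtain D where D: "\<And>t. t \<ge> 0 \<Longrightarrow> (tau i has_real_derivative D t) (at t within {0..})" "\<And>t. t \<ge> 0 \<Longrightarrow> D t \<le> d"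
      using assms(8) i by metis
    have "tau i s - tau i r \<le> d * (s - r)"
    proof (cases "r = s")
      case False
      then have "r < s" using that by simp
      have "(tau i has_derivative (*) (D x)) (at x within {r..s})" if "r \<le> x" "x \<le> s" for x
      proof (rule has_derivative_subset)
        show "(tau i has_derivative (*) (D x)) (at x within {0..})"
          using D(1)[of x] that \<open>0 \<le> r\<close> by (simp add: has_field_derivative_def)
      qed (use \<open>0 \<le> r\<close> in auto)
      from mvt_simple[OF \<open>r < s\<close> this] obtain x where "x \<in> {r<..<s}" "tau i s - tau i r = D x * (s - r)"
        by auto
      then show ?thesis using D(2)[of x] that by (simp add: mult_right_mono)
    qed simp
    then show ?thesis by (simp add: algebra_simps)
  qed
  have K: "(\<lambda>t. - (transpose B ** ple_solution A B (\<gamma> t))) = K" by (simp add: K_def fun_eq_iff)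
  have "\<exists>x. sol x0 u0 x" if "admissible_history taubar u0" for x0 u0
    using solution_exists[OF that, of "1 - d"] expand assms(6) by auto
  then show ?thesis
    unfolding closed_loop_asymptotically_stable_def K
    using lyapunov_stable attractive unfolding sol_def by blast
qed

end
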